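(* Let $k\ge1$ and let $n_1,\dots,n_\ell$ be positive integers. Let $\lambda$ be the $k$-Dyck path $u^{n_1} d^{kn_1} u^{n_2} d^{kn_2}\cdots u^{n_\ell} d^{kn_\ell}$, where $u$ means an up step and $d$ means a down step. Then $$\sum_{D\in\mathcal{D}^{(k)}(\lambda/* )} q^{\mathrm{art}_k(D)} = \genfrac{[}{]}{0pt}{}{kn_1+n_2}{n_2}_q\genfrac{[}{]}{0pt}{}{k(n_1+n_2)+n_3}{n_3}_q\cdots \genfrac{[}{]}{0pt}{}{k(n_1+\cdots+n_{\ell-1}) +n_\ell}{n_\ell}_q .$$
   Context: A $k$-Dyck path is a lattice path of up steps $(0,1)$ and down steps $(1,0)$ from $(0,0)$ to $(kn,n)$ (for some $n\ge0$) which never goes below the line $y=x/k$. Cells are unit squares with integer corners. A $k$-Dyck tile is a ribbon (finite set of cells) such that the centers of its cells are the lattice points of a translate of a $k$-Dyck path (the path of length $0$ is allowed, giving a single cell). For $k$-Dyck paths $\lambda,\mu$ from $(0,0)$ to $(kn,n)$ with $\mu$ weakly above $\lambda$, a (cover-inclusive) $k$-Dyck tiling of $\lambda/\mu$ is a tiling $D$ by $k$-Dyck tiles of the region between $\lambda$ and $\mu$ such that if $\eta$ is a tile of $D$, then the translate of $\eta$ by $(1,-1)$ is either completely below $\lambda$ or contained in another tile of $D$. $\mathcal{D}^{(k)}(\lambda/* )$ is the set of $k$-Dyck tilings with fixed lower path $\lambda$ (and arbitrary upper path $\mu$). $\mathrm{tiles}(D)$ is the number of tiles of $D$, $\mathrm{area}(D)$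 is the area (number of cells) of the region occupied by $D$, and $$\mathrm{art}_k(D)=\frac{k\cdot\mathrm{area}(D)+\mathrm{tiles}(D)}{k+1}.$$ Also $[m]_q=1+q+\cdots+q^{m-1}$, $[m]_q!=[1]_q[2]_q\cdots[m]_q$, and $\genfrac{[}{]}{0pt}{}{a}{b}_q=\frac{[a]_q!}{[a-b]_q!\,[b]_q!}$. *)

theory Defs
  imports "HOL-Library.Disjoint_Sets" "HOL-Computational_Algebra.Polynomial"
begin

section \<open>Lattice paths\<close>

datatype step = Up | Down

definition path_point :: "step list \<Rightarrow> nat \<Rightarrow> int \<times> int" where
  "path_point p i = (int (count_list (take i p) Down), int (count_list (take i p) Up))"

definition path_points :: "step list \<Rightarrow> (int \<times> int) set" where
  "path_points p = path_point p ` {..length p}"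

text \<open>\<open>kdyck_path k n p\<close>: \<open>p\<close> is a \<open>k\<close>-Dyck path from \<open>(0,0)\<close> to \<open>(kn,n)\<close>.
  The condition \<open>x \<le> k * y\<close> is \<open>y \<ge> x/k\<close>; it suffices to impose it at the lattice points.\<close>

definition kdyck_path :: "nat \<Rightarrow> nat \<Rightarrow> step list \<Rightarrow> bool" where
  "kdyck_path k n p \<longleftrightarrow>
     path_point p (length p) = (int (k * n), int n) \<and>
     (\<forall>(x, y) \<in> path_points p. x \<le> int k * y)"

text \<open>After \<open>i\<close> steps both paths are on the antidiagonal \<open>x + y = i\<close>, so the path that is
  weakly above is the one with the larger height there.\<close>

definition weakly_above :: "step list \<Rightarrow> step list \<Rightarrow> bool" where
  "weakly_above mu lam \<longleftrightarrow>
     length mu = length lam \<and>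
     (\<forall>i \<le> length lam. snd (path_point lam i) \<le> snd (path_point mu i))"

section \<open>Cells and tilings\<close>

text \<open>The cell \<open>[a, a+1] \<times> [b, b+1]\<close> is represented by its lower left corner \<open>(a, b)\<close>.
  It lies above a path iff some lattice point of the path is weakly south-east of its lower right
  corner, and below the path iff some lattice point of the path is weakly north-west of its
  upper left corner.\<close>

type_synonym cell = "int \<times> int"

definition cell_above :: "step list \<Rightarrow> cell \<Rightarrow> bool" where
  "cell_above p = (\<lambda>(a, b). \<exists>(x, y) \<in> path_points p. a + 1 \<le> x \<and> y \<le> b)"

definition cell_below :: "step list \<Rightarrow> cell \<Rightarrow> bool" where
  "cell_below p = (\<lambda>(a, b). \<exists>(x, y) \<in> path_points p. x \<le> a \<and> b + 1 \<le> y)"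

definition region_between :: "step list \<Rightarrow> step list \<Rightarrow> cell set" where
  "region_between lam mu = {c. cell_above lam c \<and> cell_below mu c}"

definition translate :: "int \<times> int \<Rightarrow> (int \<times> int) set \<Rightarrow> (int \<times> int) set" where
  "translate v S = (\<lambda>(x, y). (x + fst v, y + snd v)) ` S"

text \<open>The centre of the cell \<open>(a, b)\<close> is \<open>(a + 1/2, b + 1/2)\<close>; the shift by \<open>(1/2, 1/2)\<close> is
  absorbed in the translation, so the lower left corners form a translate of a path by an
  integer vector.\<close>

definition kdyck_tile :: "nat \<Rightarrow> cell set \<Rightarrow> bool" where
  "kdyck_tile k \<eta> \<longleftrightarrow> (\<exists>n p v. kdyck_path k n p \<and> \<eta> = translate v (path_points p))"

definition kdyck_tiling :: "nat \<Rightarrow> step list \<Rightarrow> step list \<Rightarrow> cell set set \<Rightarrow> bool" where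
  "kdyck_tiling k lam mu D \<longleftrightarrow>
     partition_on (region_between lam mu) D \<and>
     (\<forall>\<eta> \<in> D. kdyck_tile k \<eta>) \<and>
     (\<forall>\<eta> \<in> D. (\<forall>c \<in> translate (1, -1) \<eta>. cell_below lam c) \<or>
                (\<exists>\<theta> \<in> D. \<theta> \<noteq> \<eta> \<and> translate (1, -1) \<eta> \<subseteq> \<theta>))"

text \<open>A tiling determines its upper path, hence a set of tiles alone represents it.\<close>

definition kdyck_tilings :: "nat \<Rightarrow> step list \<Rightarrow> cell set set set" where
  "kdyck_tilings k lam =
     {D. \<exists>n mu. kdyck_path k n lam \<and> kdyck_path k n mu \<and> weakly_above mu lam \<and>
                kdyck_tiling k lam mu D}"

definition tiles :: "cell set set \<Rightarrow> nat" where
  "tiles D = card D"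

definition area :: "cell set set \<Rightarrow> nat" where
  "area D = card (\<Union>D)"

text \<open>The division is exact for tilings, see \<open>art_exact\<close> below.\<close>

definition art :: "nat \<Rightarrow> cell set set \<Rightarrow> nat" where
  "art k D = (k * area D + tiles D) div (k + 1)"

section \<open>\<open>q\<close>-analogues, as polynomials in the indeterminate \<open>q\<close>\<close>

abbreviation q :: "int poly" where
  "q \<equiv> monom 1 1"

definition q_int :: "nat \<Rightarrow> int poly" where
  "q_int m = (\<Sum>i<m. q ^ i)"

definition q_fact :: "nat \<Rightarrow> int poly" where
  "q_fact m = (\<Prod>i = 1..m. q_int i)"

text \<open>The division is exact for \<open>b \<le> a\<close>, see \<open>q_binom_exact\<close> below.\<close>

definition q_binom :: "nat \<Rightarrow> nat \<Rightarrow> int poly" where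
  "q_binom a b = q_fact a div (q_fact (a - b) * q_fact b)"

section \<open>The lower path: blocks of \<open>n i\<close> up steps and \<open>k * n i\<close> down steps, for \<open>i = 1, \<dots>, l\<close>\<close>

definition zigzag_path :: "nat \<Rightarrow> (nat \<Rightarrow> nat) \<Rightarrow> nat \<Rightarrow> step list" where
  "zigzag_path k n l =
     concat (map (\<lambda>i. replicate (n i) Up @ replicate (k * n i) Down) [1..<Suc l])"

section \<open>Well-definedness\<close>

lemma q_int_add: "q_int (a + b) = q_int a + q ^ a * q_int b"
proof (induction b)
  case (Suc b)
  then show ?case by (simp add: q_int_def algebra_simps power_add)
qed (simp add: q_int_def)

lemma q_fact_Suc: "q_fact (Suc m) = q_fact m * q_int (Suc m)"
  by (simp add: q_fact_def)

lemma q_fact_dvd: "q_fact a * q_fact b dvd q_fact (a + b)"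
proof (induction "a + b" arbitrary: a b)
  case 0
  then show ?case by (simp add: q_fact_def)
next
  case (Suc m)
  show ?case
  proof (cases "a = 0 \<or> b = 0")
    case True
    then show ?thesis by (auto simp: q_fact_def)
  next
    case False
    then obtain c d where ab: "a = Suc c" "b = Suc d" by (metis not0_implies_Suc)
    have m: "m = c + b" "m = a + d" using Suc.hyps(2) ab by auto
    have "q_fact c * q_fact b dvd q_fact m" "q_fact a * q_fact d dvd q_fact m"
      using Suc.hyps(1)[OF m(1)] Suc.hyps(1)[OF m(2)] m by auto
    then have 1: "q_fact a * q_fact b dvd q_fact m * q_int a"
      and 2: "q_fact a * q_fact b dvd q_fact m * q_int b"
      unfolding ab q_fact_Suc by (auto simp: mult_ac elim!: dvdE)
    have "q_fact (a + b) = q_fact m * q_int a + q ^ a * (q_fact m * q_int b)"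
      using Suc.hyps(2) q_fact_Suc[of m] q_int_add[of a b] by (simp add: algebra_simps)
    then show ?thesis using 1 2 by (metis dvd_add dvd_mult)
  qed
qed

lemma q_fact_nonzero: "q_fact m \<noteq> 0"
proof -
  have "q_int i \<noteq> 0" if "i \<ge> 1" for i
  proof -
    have "poly (q_int i) 1 = int i" by (simp add: q_int_def poly_sum poly_monom)
    then show ?thesis using that by auto
  qed
  then show ?thesis by (simp add: q_fact_def)
qed

lemma q_binom_exact:
  assumes "b \<le> a"
  shows "q_binom a b * (q_fact (a - b) * q_fact b) = q_fact a"
  using q_fact_dvd[of "a - b" b] assms by (simp add: q_binom_def)

lemma count_list_steps: "count_list p Down + count_list p Up = length p"
proof (induction p)
  case (Cons s p)
  then show ?case by (cases s) auto
qed simp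

lemma path_point_sum:
  assumes "i \<le> length p"
  shows "fst (path_point p i) + snd (path_point p i) = int i"
proof -
  have "count_list (take i p) Down + count_list (take i p) Up = i"
    using count_list_steps[of "take i p"] assms by simp
  then show ?thesis by (simp add: path_point_def flip: of_nat_add)
qed

lemma card_kdyck_tile:
  assumes "kdyck_tile k \<eta>"
  obtains n where "card \<eta> = (k + 1) * n + 1"
proof -
  obtain n p v where p: "kdyck_path k n p" "\<eta> = translate v (path_points p)"
    using assms by (auto simp: kdyck_tile_def)
  have "inj_on (path_point p) {..length p}"
  proof (rule inj_onI)
    fix i j assume "i \<in> {..length p}" "j \<in> {..length p}" "path_point p i = path_point p j"
    then show "i = j" by (metis atMost_iff path_point_sum of_nat_eq_iff)
  qed
  then have "card (path_points p) = length p + 1"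
    by (simp add: path_points_def card_image)
  moreover have "int (length p) = int (k * n + n)"
    using path_point_sum[OF order_refl, of p] p(1) unfolding kdyck_path_def by simp
  moreover have "card \<eta> = card (path_points p)"
    unfolding p(2) translate_def by (rule card_image) (auto simp: inj_on_def)
  ultimately have "card \<eta> = (k + 1) * n + 1" by (simp only: of_nat_eq_iff) simp
  then show ?thesis using that by blast
qed

lemma finite_region_between: "finite (region_between lam mu)"
proof -
  let ?L = "int (length lam)" and ?M = "int (length mu)"
  have bd: "0 \<le> x \<and> x \<le> int (length p) \<and> 0 \<le> y \<and> y \<le> int (length p)"
    if xy: "(x, y) \<in> path_points p" for x y p
  proof -
    obtain i where i: "i \<le> length p" "(x, y) = path_point p i"
      using xy unfolding path_points_def by blast
    have "0 \<le> x" "0 \<le> y" using i by (auto simp: path_point_def)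
    moreover have "x + y = int i" using path_point_sum[OF i(1)] i(2) by (metis fst_conv snd_conv)
    ultimately show ?thesis using i(1) by linarith
  qed
  have "region_between lam mu \<subseteq> {0..?L} \<times> {0..?M}"
  proof
    fix c assume c: "c \<in> region_between lam mu"
    obtain a b where ab: "c = (a, b)" by (cases c)
    obtain x y where 1: "(x, y) \<in> path_points lam" "a + 1 \<le> x" "y \<le> b"
      using c unfolding region_between_def cell_above_def ab by blast
    obtain x' y' where 2: "(x', y') \<in> path_points mu" "x' \<le> a" "b + 1 \<le> y'"
      using c unfolding region_between_def cell_below_def ab by blast
    show "c \<in> {0..?L} \<times> {0..?M}"
      using bd[OF 1(1)] bd[OF 2(1)] 1(2,3) 2(2,3) unfolding ab mem_Times_iff by simp
  qed
  then show ?thesis by (rule finite_subset) simp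
qed

lemma finite_kdyck_tilings: "finite (kdyck_tilings k lam)"
proof -
  have "UNIV = {Up, Down}" using step.exhaust by auto
  then have "finite (UNIV :: step set)" by (metis finite.emptyI finite.insertI)
  then have "finite {mu :: step list. length mu = length lam}"
    using finite_lists_length_eq[of UNIV "length lam"] by simp
  then have "finite (\<Union>mu \<in> {mu. length mu = length lam}. Pow (Pow (region_between lam mu)))"
    by (simp add: finite_region_between)
  moreover have "kdyck_tilings k lam \<subseteq>
      (\<Union>mu \<in> {mu. length mu = length lam}. Pow (Pow (region_between lam mu)))"
    by (fastforce simp: kdyck_tilings_def kdyck_tiling_def weakly_above_def partition_on_def)
  ultimately show ?thesis by (rule rev_finite_subset)
qed

lemma art_exact:
  assumes "D \<in> kdyck_tilings k lam"
  shows "(k + 1) * art k D = k * area D + tiles D"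
proof -
  obtain mu where D: "partition_on (region_between lam mu) D" "\<forall>\<eta> \<in> D. kdyck_tile k \<eta>"
    using assms by (auto simp: kdyck_tilings_def kdyck_tiling_def)
  have fin: "finite \<eta>" if "\<eta> \<in> D" for \<eta>
  proof (rule finite_subset[OF _ finite_region_between])
    show "\<eta> \<subseteq> region_between lam mu"
      using that D(1) by (auto simp: partition_on_def)
  qed
  have "area D = (\<Sum>\<eta>\<in>D. card \<eta>)"
    unfolding area_def using D(1) fin
    by (intro card_Union_disjoint) (auto simp: partition_on_def disjoint_def pairwise_def disjnt_def)
  then have "k * area D + tiles D = (\<Sum>\<eta>\<in>D. k * card \<eta> + 1)"
    by (simp only: tiles_def sum.distrib sum_distrib_left card_eq_sum)
  moreover have "(k + 1) dvd (\<Sum>\<eta>\<in>D. k * card \<eta> + 1)"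
  proof (rule dvd_sum)
    fix \<eta> assume "\<eta> \<in> D"
    then obtain n where "card \<eta> = (k + 1) * n + 1" using D(2) card_kdyck_tile by blast
    then have "k * card \<eta> + 1 = (k + 1) * (k * n + 1)" by (simp add: algebra_simps)
    then show "(k + 1) dvd k * card \<eta> + 1" by (metis dvd_triv_left)
  qed
  ultimately show ?thesis by (simp only: art_def dvd_mult_div_cancel)
qed

lemma zigzag_path_Suc:
  "zigzag_path k n (Suc l) =
     zigzag_path k n l @ replicate (n (Suc l)) Up @ replicate (k * n (Suc l)) Down"
  by (simp add: zigzag_path_def)

lemma path_points_append:
  "path_points (p @ r) =
     path_points p \<union> translate (path_point p (length p)) (path_points r)"
proof -
  have 1: "path_point (p @ r) i = path_point p i" if "i \<le> length p" for i
    using that by (simp add: path_point_def)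
  have 2: "path_point (p @ r) (length p + j) =
      (\<lambda>(x, y). (x + fst (path_point p (length p)), y + snd (path_point p (length p))))
        (path_point r j)" for j
    by (simp add: path_point_def)
  have "{..length (p @ r)} = {..length p} \<union> (\<lambda>j. length p + j) ` {..length r}"
  proof (intro equalityI subsetI)
    fix x assume x: "x \<in> {..length (p @ r)}"
    show "x \<in> {..length p} \<union> (\<lambda>j. length p + j) ` {..length r}"
    proof (cases "x \<le> length p")
      case False
      then have "x = length p + (x - length p)" "x - length p \<in> {..length r}"
        using x by auto
      then show ?thesis by blast
    qed simp
  qed auto
  then show ?thesis
    unfolding path_points_def translate_def
    by (simp add: image_Un image_image 1 2)
qed

lemma kdyck_path_zigzag: "kdyck_path k (\<Sum>i = 1..l. n i) (zigzag_path k n l)"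
proof (induction l)
  case 0
  then show ?case by (simp add: kdyck_path_def zigzag_path_def path_points_def path_point_def)
next
  case (Suc l)
  let ?p = "zigzag_path k n l" and ?m = "n (Suc l)"
  let ?r = "replicate ?m Up @ replicate (k * ?m) Down"
  have end_p: "path_point ?p (length ?p) = (int k * (\<Sum>i = 1..l. int (n i)), (\<Sum>i = 1..l. int (n i)))"
    using Suc by (simp add: kdyck_path_def)
  have cnt: "count_list (replicate a s) t = (if s = t then a else 0)" for a and s t :: step
    by (induction a) auto
  have r: "x \<le> int k * y" if xy: "(x, y) \<in> path_points ?r" for x y
  proof -
    obtain i where i: "x = int (count_list (take i ?r) Down)" "y = int (count_list (take i ?r) Up)"
      using xy unfolding path_points_def path_point_def by (elim imageE) blast
    have xy': "x = int (min (i - ?m) (k * ?m))" "y = int (min i ?m)"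
      by (simp_all add: i cnt)
    show ?thesis
    proof (cases "i \<le> ?m")
      case False
      then have "y = int ?m" using xy' by simp
      moreover have "x \<le> int (k * ?m)" unfolding xy'(1) of_nat_le_iff by (rule min.cobounded2)
      ultimately show ?thesis by simp
    qed (simp add: xy')
  qed
  have "path_point (?p @ ?r) (length (?p @ ?r)) =
      (int k * (\<Sum>i = 1..Suc l. int (n i)), (\<Sum>i = 1..Suc l. int (n i)))"
    using end_p by (simp add: path_point_def cnt algebra_simps)
  moreover have "x \<le> int k * y" if xy: "(x, y) \<in> path_points (?p @ ?r)" for x y
  proof -
    let ?N = "\<Sum>i = 1..l. int (n i)"
    consider "(x, y) \<in> path_points ?p"
      | "(x, y) \<in> translate (int k * ?N, ?N) (path_points ?r)"
      using xy unfolding path_points_append[of ?p ?r] end_p by blast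
    then show ?thesis
    proof cases
      case 1
      then show ?thesis using Suc unfolding kdyck_path_def by blast
    next
      case 2
      then obtain x' y' where "(x', y') \<in> path_points ?r" "x = x' + int k * ?N" "y = y' + ?N"
        unfolding translate_def by auto
      then show ?thesis using r[of x' y'] by (simp add: distrib_left)
    qed
  qed
  ultimately show ?case
    unfolding kdyck_path_def zigzag_path_Suc by (simp only: of_nat_mult of_nat_sum) blast
qed

end

theory Submission
  imports Defs
begin

text \<open>
  A cell above the lower path \<open>\<lambda>\<close> is determined by the position \<open>i\<close> of the point of \<open>\<lambda>\<close> on the
  antidiagonal through its corners and by its level \<open>j\<close>, counted from \<open>\<lambda>\<close> along this antidiagonal.  The
  translation by \<open>(1,-1)\<close> fixes the position and lowers the level by one, so cover-inclusiveness
  forces all cells of a tile to have the same level (\<open>tile_constant_level\<close>).  A tile is therefore a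
  copy of a segment of \<open>\<lambda>\<close> that is itself a \<open>k\<close>-Dyck path, and a tiling is a stack of families of
  disjoint \<open>k\<close>-Dyck segments of \<open>\<lambda>\<close>, each segment lying inside one of the family below it.  In a \<open>k\<close>-Dyck segment
  every down step lies under the arch of some up step, so a family is known once it is known which
  up steps lie inside its segments.  This encodes a tiling by two functions: \<open>h i\<close> is the number of
  cells over position \<open>i\<close>, and \<open>c u\<close> is the number of levels at which the up step \<open>u\<close> lies inside a
  tile (\<open>tiling_of_h_c\<close>, \<open>tiling_of_inj\<close>, \<open>tiling_of_in_kdyck_tilings\<close>).  A tile with \<open>m\<close> up steps
  has \<open>(k+1)m+1\<close> cells and contributes \<open>km+1\<close> to the art statistic, whence \<open>art = \<Sum>h - \<Sum>c\<close>.

  All valleys of the path \<open>\<lambda>\<close> of the theorem are on the line \<open>y = x/k\<close>.  For such a path the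
  compatibility conditions between \<open>h\<close> and \<open>c\<close> are local, so that tilings become walks of pairs
  \<open>(h,c)\<close> along \<open>\<lambda>\<close>: an up step keeps \<open>h\<close> or lowers it by one and may raise \<open>c\<close> up to the new \<open>h\<close>;
  a down step keeps \<open>h\<close> or raises it by one and resets \<open>c\<close> to \<open>0\<close>
  (\<open>sum_kdyck_tilings_eq_sum_walks\<close>).  Each step has weight \<open>q^(h-c)\<close>.

  The walks are summed from left to right.  With \<open>m = k(n\<^sub>1 + \<dots> + n\<^sub>j)\<close>, the walks over the first
  \<open>j\<close> hills that end at height \<open>a\<close> have total weight \<open>q^(a(a+1)/2) [m choose a]\<close> times a factor
  independent of \<open>a\<close> (\<open>transfer_zigzag\<close>).  A down step replaces \<open>m\<close> by \<open>m+1\<close>, by Pascal's rule.  An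
  ascent of \<open>n\<close> up steps, with its choices of \<open>c\<close>, multiplies everything by \<open>[m+n choose n]\<close>, by the \<open>q\<close>-Vandermonde
  identity.  These multipliers are the factors of the theorem, and a complete tiling is a walk that
  ends at \<open>a = 0\<close>.
\<close>

section \<open>Gaussian binomial coefficients\<close>

text \<open>
  Pascal's rule gives values for all arguments, including \<open>r > n\<close>, where the quotient of
  \<open>q\<close>-factorials has no meaning; sums over too large a range are then harmless.
\<close>

fun gauss :: "nat \<Rightarrow> nat \<Rightarrow> int poly" where
  "gauss n 0 = 1"
| "gauss 0 (Suc r) = 0"
| "gauss (Suc n) (Suc r) = q ^ Suc r * gauss n (Suc r) + gauss n r"

lemma gauss_eq_0: "n < r \<Longrightarrow> gauss n r = 0"
  by (induction n r rule: gauss.induct) auto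

lemma gauss_self [simp]: "gauss n n = 1"
  by (induction n) (auto simp: gauss_eq_0)

text \<open>
  Both sides satisfy Pascal's rule, because \<open>[a+b] = [b] + q^b [a]\<close>.
\<close>

lemma gauss_mult_q_fact: "gauss (a + b) b * (q_fact a * q_fact b) = q_fact (a + b)"
proof (induction "a + b" arbitrary: a b)
  case 0
  then show ?case by (simp add: q_fact_def)
next
  case (Suc m)
  show ?case
  proof (cases "a = 0 \<or> b = 0")
    case True
    then show ?thesis by (auto simp: q_fact_def)
  next
    case False
    then obtain c d where ab: "a = Suc c" "b = Suc d" by (metis not0_implies_Suc)
    have 1: "gauss (c + b) b * (q_fact c * q_fact b) = q_fact (c + b)"
      using Suc.hyps ab by (intro Suc.hyps(1)) simp
    have eq: "a + b = Suc (c + b)" "a + d = c + b" using ab by auto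
    have 2: "gauss (c + b) d * (q_fact a * q_fact d) = q_fact (c + b)"
      unfolding eq(2)[symmetric] using Suc.hyps ab by (intro Suc.hyps(1)) simp
    have "gauss (a + b) b * (q_fact a * q_fact b)
        = (q ^ b * gauss (c + b) b + gauss (c + b) d) * (q_fact a * q_fact b)"
      using eq ab by simp
    also have "\<dots> = q ^ b * (gauss (c + b) b * (q_fact c * q_fact b)) * q_int a
        + (gauss (c + b) d * (q_fact a * q_fact d)) * q_int b"
      unfolding ab q_fact_Suc by (simp only: algebra_simps)
    also have "\<dots> = q_fact (c + b) * (q_int b + q ^ b * q_int a)"
      unfolding 1 2 by (simp only: algebra_simps)
    also have "\<dots> = q_fact (a + b)"
      using q_fact_Suc[of "c + b"] q_int_add[of b a] eq(1) by (simp add: add.commute)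
    finally show ?thesis .
  qed
qed

lemma gauss_eq_q_binom: "gauss (a + b) b = q_binom (a + b) b"
proof -
  have "gauss (a + b) b * (q_fact a * q_fact b) = q_binom (a + b) b * (q_fact a * q_fact b)"
    using gauss_mult_q_fact[of a b] q_binom_exact[of b "a + b"] by simp
  then show ?thesis by (simp add: q_fact_nonzero)
qed

lemma gauss_symmetric: "gauss (a + b) b = gauss (a + b) a"
proof -
  have "gauss (a + b) b * (q_fact a * q_fact b) = gauss (a + b) a * (q_fact a * q_fact b)"
    using gauss_mult_q_fact[of a b] gauss_mult_q_fact[of b a] by (simp add: ac_simps)
  then show ?thesis by (simp add: q_fact_nonzero)
qed

text \<open>
  For \<open>h \<le> m\<close>, both products are \<open>[m+n]! / ([n]! [h]! [m-h]!)\<close>, the number of ways to split off blocks of sizes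
  \<open>n\<close> and \<open>h\<close>, in two orders.  Otherwise both vanish.
\<close>

lemma gauss_trinomial:
  "gauss (h + n) n * gauss (m + n) (n + h) = gauss (m + n) n * gauss m h"
proof (cases "h \<le> m")
  case True
  then obtain d where m: "m = d + h" by (metis le_add_diff_inverse2)
  let ?F = "q_fact d * q_fact h * q_fact n * (q_fact (h + n) * q_fact m)"
  have 1: "gauss (h + n) n * (q_fact h * q_fact n) = q_fact (h + n)"
    and 2: "gauss (m + n) (n + h) * (q_fact d * q_fact (h + n)) = q_fact (m + n)"
    and 3: "gauss (m + n) n * (q_fact m * q_fact n) = q_fact (m + n)"
    and 4: "gauss m h * (q_fact d * q_fact h) = q_fact m"
    using gauss_mult_q_fact[of h n] gauss_mult_q_fact[of d "h + n"] gauss_mult_q_fact[of m n]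
      gauss_mult_q_fact[of d h] m by (simp_all add: ac_simps)
  have "gauss (h + n) n * gauss (m + n) (n + h) * ?F
      = (gauss (h + n) n * (q_fact h * q_fact n))
        * (gauss (m + n) (n + h) * (q_fact d * q_fact (h + n))) * q_fact m"
    by (simp only: ac_simps)
  also have "\<dots> = (gauss (m + n) n * (q_fact m * q_fact n)) * (gauss m h * (q_fact d * q_fact h))
        * q_fact (h + n)"
    unfolding 1 2 3 4 by (simp only: ac_simps)
  also have "\<dots> = gauss (m + n) n * gauss m h * ?F" by (simp only: ac_simps)
  finally show ?thesis by (simp add: q_fact_nonzero)
qed (simp add: gauss_eq_0)

text \<open>
  This sums over the value of the first link count of an ascent, see \<open>transfer_ascent\<close>.
\<close>

lemma gauss_hockey_stick: "(\<Sum>x\<le>h. q ^ x * gauss (x + n) n) = gauss (h + Suc n) (Suc n)"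
proof (induction h)
  case (Suc h)
  have "gauss (Suc h + Suc n) (Suc n) = gauss (Suc n + Suc h) (Suc h)"
    using gauss_symmetric[of "Suc h" "Suc n"] by (simp add: ac_simps)
  also have "\<dots> = q ^ Suc h * gauss (n + Suc h) (Suc h) + gauss (Suc n + h) h" by simp
  also have "\<dots> = q ^ Suc h * gauss (Suc h + n) n + gauss (h + Suc n) (Suc n)"
    using gauss_symmetric[of "Suc h" n] gauss_symmetric[of h "Suc n"] by (simp add: ac_simps)
  finally show ?case using Suc by simp
qed simp

text \<open>
  Induction on \<open>n\<close>: expanding \<open>gauss (Suc n) j\<close> by Pascal's rule, the two resulting sums are instances
  for \<open>n\<close> and recombine by Pascal's rule for \<open>gauss (m + Suc n) r\<close>.
\<close>

lemma gauss_vandermonde: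
  "(\<Sum>j\<le>r. q ^ ((n - j) * (r - j)) * gauss m (r - j) * gauss n j) = gauss (m + n) r"
proof (induction n arbitrary: r)
  case 0
  have "(\<Sum>j\<le>r. q ^ ((0 - j) * (r - j)) * gauss m (r - j) * gauss 0 j)
      = (\<Sum>j\<in>{0}. q ^ ((0 - j) * (r - j)) * gauss m (r - j) * gauss 0 j)"
    by (intro sum.mono_neutral_right) (auto simp: gauss_eq_0)
  then show ?case by simp
next
  case (Suc n)
  show ?case
  proof (cases r)
    case (Suc s)
    have first: "q ^ ((Suc n - j) * (r - j)) * q ^ j * gauss n j
        = q ^ r * (q ^ ((n - j) * (r - j)) * gauss n j)" if "j \<le> r" for j
    proof (cases "j \<le> n")
      case True
      then have "(Suc n - j) * (r - j) + j = r + (n - j) * (r - j)"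
        using that by (simp add: Suc_diff_le)
      then show ?thesis by (simp add: mult.assoc[symmetric] power_add[symmetric])
    qed (simp add: gauss_eq_0)
    have "(\<Sum>j\<le>r. q ^ ((Suc n - j) * (r - j)) * gauss m (r - j) * gauss (Suc n) j)
        = (\<Sum>j\<le>r. q ^ ((Suc n - j) * (r - j)) * gauss m (r - j) * (q ^ j * gauss n j))
        + (\<Sum>j\<le>s. q ^ ((n - j) * (s - j)) * gauss m (s - j) * gauss n j)"
      unfolding Suc sum.atMost_Suc_shift by (simp add: sum.distrib algebra_simps)
    also have "(\<Sum>j\<le>r. q ^ ((Suc n - j) * (r - j)) * gauss m (r - j) * (q ^ j * gauss n j))
        = (\<Sum>j\<le>r. q ^ r * (q ^ ((n - j) * (r - j)) * gauss m (r - j) * gauss n j))"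
    proof (intro sum.cong refl)
      fix j assume "j \<in> {..r}"
      have "q ^ ((Suc n - j) * (r - j)) * gauss m (r - j) * (q ^ j * gauss n j)
          = gauss m (r - j) * (q ^ ((Suc n - j) * (r - j)) * q ^ j * gauss n j)"
        by (simp only: ac_simps)
      also have "\<dots> = gauss m (r - j) * (q ^ r * (q ^ ((n - j) * (r - j)) * gauss n j))"
        using first \<open>j \<in> {..r}\<close> by simp
      finally show "q ^ ((Suc n - j) * (r - j)) * gauss m (r - j) * (q ^ j * gauss n j)
          = q ^ r * (q ^ ((n - j) * (r - j)) * gauss m (r - j) * gauss n j)"
        by (simp only: ac_simps)
    qed
    also have "\<dots> = q ^ r * gauss (m + n) r"
      by (simp only: sum_distrib_left[symmetric] Suc.IH)
    finally show ?thesis unfolding Suc.IH using Suc by simp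
  qed (use Suc in simp)
qed

text \<open>
  Reversal of the summation range turns the exponent into the one met when an ascent of \<open>n\<close> steps
  loses \<open>r\<close> units of height.
\<close>

lemma gauss_vandermonde_shifted:
  "(\<Sum>r\<le>n. q ^ (r * (h + r)) * gauss m (h + r) * gauss n r) = gauss (m + n) (n + h)"
proof -
  have "(\<Sum>j\<le>n + h. q ^ ((n - j) * (n + h - j)) * gauss m (n + h - j) * gauss n j)
      = (\<Sum>j\<le>n. q ^ ((n - j) * (n + h - j)) * gauss m (n + h - j) * gauss n j)"
    by (intro sum.mono_neutral_right) (auto simp: gauss_eq_0)
  also have "\<dots> = (\<Sum>r\<le>n. q ^ (r * (h + r)) * gauss m (h + r) * gauss n r)"
  proof (rule sum.reindex_bij_witness[of _ "\<lambda>r. n - r" "\<lambda>r. n - r"])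
    fix r assume "r \<in> {..n}"
    then obtain d where n: "n = d + r" by (metis atMost_iff le_add_diff_inverse2)
    show "q ^ ((n - r) * (h + (n - r))) * gauss m (h + (n - r)) * gauss n (n - r)
        = q ^ ((n - r) * (n + h - r)) * gauss m (n + h - r) * gauss n r"
      using gauss_symmetric[of d r] by (simp add: n add.commute)
  qed auto
  finally show ?thesis unfolding gauss_vandermonde by (rule sym)
qed

section \<open>Transfer operators along the path\<close>

text \<open>
  The state \<open>(h, c)\<close> after a step of the lower path consists of the number \<open>h\<close> of cells over the
  point reached and the number \<open>c\<close> of levels at which that step, if it is an up step, lies inside a
  tile.  On an ascent \<open>c\<close> is weakly increasing, since a tile containing one up step contains the
  later up steps of the same ascent; after a down step no constraint remains, whence the \<open>0\<close>.
\<close>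

fun moves :: "step \<Rightarrow> nat \<times> nat \<Rightarrow> (nat \<times> nat) set" where
  "moves Up (h, c) = {(h', c'). (h' = h \<or> Suc h' = h) \<and> c \<le> c' \<and> c' \<le> h'}"
| "moves Down (h, c) = {(h, 0), (Suc h, 0)}"

definition transfer :: "step \<Rightarrow> (nat \<times> nat \<Rightarrow> int poly) \<Rightarrow> nat \<times> nat \<Rightarrow> int poly" where
  "transfer s g x = (\<Sum>y\<in>moves s x. q ^ (fst y - snd y) * g y)"

lemma moves_Up_eq:
  "moves Up (h, c) = Pair h ` {c..h} \<union> (if h = 0 then {} else Pair (h - 1) ` {c..h - 1})"
  by auto

lemma finite_moves: "finite (moves s x)"
  by (cases s; cases x) (simp_all add: moves_Up_eq del: moves.simps(1))

lemma transfer_Down: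
  "transfer Down g (h, c) = q ^ h * g (h, 0) + q ^ Suc h * g (Suc h, 0)"
  by (simp add: transfer_def)

lemma transfer_Up:
  "transfer Up g (h, c) = (\<Sum>c'=c..h. q ^ (h - c') * g (h, c'))
     + (if h = 0 then 0 else \<Sum>c'=c..h - 1. q ^ (h - 1 - c') * g (h - 1, c'))"
  unfolding transfer_def moves_Up_eq
  by (subst sum.union_disjoint) (auto simp: sum.reindex inj_on_def)

text \<open>
  Exchange of the two sums leaves, for every final height \<open>b\<close>, a hockey stick sum over \<open>c'\<close>.
\<close>

lemma sum_ascent_links:
  fixes w g :: "nat \<Rightarrow> int poly"
  shows "(\<Sum>c'=c..h. q ^ (h - c') * (\<Sum>b=c'..h. w b * gauss (b - c' + n) n * g b))
     = (\<Sum>b=c..h. q ^ (h - b) * w b * gauss (b - c + Suc n) (Suc n) * g b)"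
proof -
  have "(\<Sum>c'=c..h. q ^ (h - c') * (\<Sum>b=c'..h. w b * gauss (b - c' + n) n * g b))
      = (\<Sum>c'\<in>{c..h}. \<Sum>b\<in>{b\<in>{c..h}. c' \<le> b}. q ^ (h - c') * (w b * gauss (b - c' + n) n * g b))"
    by (intro sum.cong refl) (auto simp: sum_distrib_left intro!: sum.cong)
  also have "\<dots> = (\<Sum>b\<in>{c..h}. \<Sum>c'\<in>{c'\<in>{c..h}. c' \<le> b}.
      q ^ (h - c') * (w b * gauss (b - c' + n) n * g b))"
    by (rule sum.swap_restrict) auto
  also have "\<dots> = (\<Sum>b=c..h. q ^ (h - b) * w b * gauss (b - c + Suc n) (Suc n) * g b)"
  proof (intro sum.cong refl)
    fix b assume b: "b \<in> {c..h}"
    have "(\<Sum>c'\<in>{c'\<in>{c..h}. c' \<le> b}. q ^ (h - c') * (w b * gauss (b - c' + n) n * g b))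
        = (\<Sum>x\<le>b - c. q ^ (h - b) * w b * g b * (q ^ x * gauss (x + n) n))"
    proof (rule sum.reindex_bij_witness[of _ "\<lambda>x. b - x" "\<lambda>c'. b - c'"])
      fix c' assume c': "c' \<in> {c'\<in>{c..h}. c' \<le> b}"
      then have "h - c' = (h - b) + (b - c')" using b by auto
      then show "q ^ (h - b) * w b * g b * (q ^ (b - c') * gauss (b - c' + n) n)
          = q ^ (h - c') * (w b * gauss (b - c' + n) n * g b)"
        by (simp only: power_add ac_simps)
    qed (use b in auto)
    also have "\<dots> = q ^ (h - b) * w b * g b * gauss (b - c + Suc n) (Suc n)"
      by (simp only: sum_distrib_left[symmetric] gauss_hockey_stick)
    finally show "(\<Sum>c'\<in>{c'\<in>{c..h}. c' \<le> b}. q ^ (h - c') * (w b * gauss (b - c' + n) n * g b))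
        = q ^ (h - b) * w b * gauss (b - c + Suc n) (Suc n) * g b"
      by (simp only: ac_simps)
  qed
  finally show ?thesis .
qed

text \<open>
  Over an ascent that ends at height \<open>b\<close>, the heights and the link counts are independent of each
  other once the weight \<open>h - c\<close> is split as \<open>(h - b) + (b - c)\<close>.  The heights choose \<open>h - b\<close> of the
  \<open>n\<close> steps at which to drop; the link counts form a weakly increasing sequence in \<open>{c..b}\<close>.
\<close>

lemma transfer_ascent:
  assumes "c \<le> h"
  shows "(transfer Up ^^ n) (g \<circ> fst) (h, c)
    = (\<Sum>b=c..h. q ^ ((h - b) choose 2) * gauss n (h - b) * gauss (b - c + n) n * g b)"
  using assms
proof (induction n arbitrary: h c)
  case 0
  have "(\<Sum>b=c..h. q ^ ((h - b) choose 2) * gauss 0 (h - b) * gauss (b - c + 0) 0 * g b)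
      = (\<Sum>b\<in>{h}. q ^ ((h - b) choose 2) * gauss 0 (h - b) * gauss (b - c + 0) 0 * g b)"
    using 0 by (intro sum.mono_neutral_right) (auto simp: gauss_eq_0)
  then show ?case by (simp add: numeral_2_eq_2)
next
  case (Suc n)
  have pascal: "q ^ Suc i * (q ^ (Suc i choose 2) * gauss n (Suc i)) + q ^ i * (q ^ (i choose 2) * gauss n i)
      = q ^ (Suc i choose 2) * gauss (Suc n) (Suc i)" for i
  proof -
    have "q ^ i * (q ^ (i choose 2) * gauss n i) = q ^ (Suc i choose 2) * gauss n i"
      by (simp add: numeral_2_eq_2 power_add)
    then show ?thesis by (simp only: gauss.simps(3) distrib_left mult.left_commute)
  qed
  have step: "(\<Sum>c'=c..a. q ^ (a - c') * (transfer Up ^^ n) (g \<circ> fst) (a, c'))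
      = (\<Sum>b=c..a. q ^ (a - b) * (q ^ ((a - b) choose 2) * gauss n (a - b))
           * gauss (b - c + Suc n) (Suc n) * g b)" for a
    unfolding sum_ascent_links[symmetric] by (intro sum.cong refl) (simp only: Suc.IH atLeastAtMost_iff)
  show ?case
  proof (cases h)
    case 0
    then show ?thesis using step[of h] Suc.prems by (simp add: transfer_Up numeral_2_eq_2)
  next
    case (Suc a)
    have "(transfer Up ^^ Suc n) (g \<circ> fst) (h, c)
      = (\<Sum>b=c..Suc a. q ^ (h - b) * (q ^ ((h - b) choose 2) * gauss n (h - b))
           * gauss (b - c + Suc n) (Suc n) * g b)
      + (\<Sum>b=c..a. q ^ (a - b) * (q ^ ((a - b) choose 2) * gauss n (a - b))
           * gauss (b - c + Suc n) (Suc n) * g b)"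
      using step[of h] step[of a] Suc by (simp add: transfer_Up)
    also have "\<dots> = gauss (h - c + Suc n) (Suc n) * g h
      + (\<Sum>b=c..a. q ^ ((h - b) choose 2) * gauss (Suc n) (h - b) * gauss (b - c + Suc n) (Suc n) * g b)"
    proof -
      have "(\<Sum>b=c..a. q ^ (h - b) * (q ^ ((h - b) choose 2) * gauss n (h - b))
             * gauss (b - c + Suc n) (Suc n) * g b)
          + (\<Sum>b=c..a. q ^ (a - b) * (q ^ ((a - b) choose 2) * gauss n (a - b))
             * gauss (b - c + Suc n) (Suc n) * g b)
        = (\<Sum>b=c..a. q ^ ((h - b) choose 2) * gauss (Suc n) (h - b) * gauss (b - c + Suc n) (Suc n) * g b)"
        unfolding sum.distrib[symmetric]
      proof (intro sum.cong refl)
        fix b assume "b \<in> {c..a}"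
        then have "h - b = Suc (a - b)" using Suc by auto
        then show "q ^ (h - b) * (q ^ ((h - b) choose 2) * gauss n (h - b))
               * gauss (b - c + Suc n) (Suc n) * g b
            + q ^ (a - b) * (q ^ ((a - b) choose 2) * gauss n (a - b))
               * gauss (b - c + Suc n) (Suc n) * g b
          = q ^ ((h - b) choose 2) * gauss (Suc n) (h - b) * gauss (b - c + Suc n) (Suc n) * g b"
          by (simp only: pascal[symmetric] distrib_right)
      qed
      moreover have "{c..Suc a} = insert h {c..a}" "h \<notin> {c..a}" using Suc Suc.prems by auto
      ultimately show ?thesis by (simp add: numeral_2_eq_2)
    qed
    also have "\<dots> = (\<Sum>b=c..h. q ^ ((h - b) choose 2) * gauss (Suc n) (h - b)
        * gauss (b - c + Suc n) (Suc n) * g b)"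
    proof -
      have "{c..h} = insert h {c..a}" "h \<notin> {c..a}" using Suc Suc.prems by auto
      then show ?thesis by (simp add: numeral_2_eq_2)
    qed
    finally show ?thesis .
  qed
qed

text \<open>
  The value of a function \<open>g\<close> of the height, summed over all walks along a prefix of the path that
  ends with a descent, up to a constant factor; compare \<open>\<Prod>i=1..m. (1 + z q^i)\<close>, whose coefficient
  of \<open>z^a\<close> is the coefficient of \<open>g a\<close>.
\<close>

definition binomial_functional :: "nat \<Rightarrow> (nat \<Rightarrow> int poly) \<Rightarrow> int poly" where
  "binomial_functional m g = (\<Sum>a\<le>m. q ^ (Suc a choose 2) * gauss m a * g a)"

text \<open>
  The transfer operator of a down step on functions of the height alone.
\<close>

definition descend :: "(nat \<Rightarrow> int poly) \<Rightarrow> nat \<Rightarrow> int poly" where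
  "descend g a = q ^ a * g a + q ^ Suc a * g (Suc a)"

text \<open>
  A down step resets the link count, so after a nonempty descent only the height matters.
\<close>

lemma transfer_descent:
  assumes "d > 0"
  shows "(transfer Down ^^ d) g = (descend ^^ d) (\<lambda>a. g (a, 0)) \<circ> fst"
proof -
  have one: "transfer Down f = descend (\<lambda>a. f (a, 0)) \<circ> fst" for f
    by (auto simp: fun_eq_iff transfer_Down descend_def)
  have "(transfer Down ^^ Suc e) g = (descend ^^ Suc e) (\<lambda>a. g (a, 0)) \<circ> fst" for e
  proof (induction e)
    case (Suc e)
    have "(transfer Down ^^ Suc (Suc e)) g = transfer Down ((transfer Down ^^ Suc e) g)" by simp
    then show ?case unfolding Suc one by (simp add: o_def)
  qed (simp add: one)
  then show ?thesis using assms by (metis gr0_implies_Suc)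
qed

text \<open>
  Comparing the coefficients of \<open>g a\<close>, this is Pascal's rule.
\<close>

lemma binomial_functional_descend:
  "binomial_functional m (descend g) = binomial_functional (Suc m) g"
proof -
  have 1: "q ^ (Suc (Suc a) choose 2) = q ^ (Suc a choose 2) * q ^ Suc a" for a
    by (simp add: numeral_2_eq_2 power_add)
  have "binomial_functional (Suc m) g = g 0
      + (\<Sum>a\<le>m. q ^ (Suc (Suc a) choose 2) * q ^ Suc a * gauss m (Suc a) * g (Suc a))
      + (\<Sum>a\<le>m. q ^ (Suc a choose 2) * gauss m a * (q ^ Suc a * g (Suc a)))"
    unfolding binomial_functional_def sum.atMost_Suc_shift[of _ m]
    by (simp only: 1 gauss.simps sum.distrib[symmetric] add.assoc)
      (simp add: algebra_simps numeral_2_eq_2)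
  also have "(\<Sum>a\<le>m. q ^ (Suc (Suc a) choose 2) * q ^ Suc a * gauss m (Suc a) * g (Suc a))
      = (\<Sum>a<m. q ^ (Suc (Suc a) choose 2) * q ^ Suc a * gauss m (Suc a) * g (Suc a))"
    by (intro sum.mono_neutral_right) (auto simp: gauss_eq_0)
  also have "g 0 + \<dots> = (\<Sum>a\<le>m. q ^ (Suc a choose 2) * gauss m a * (q ^ a * g a))"
    by (simp only: lessThan_Suc_atMost[symmetric] sum.lessThan_Suc_shift)
      (simp add: algebra_simps numeral_2_eq_2)
  finally show ?thesis
    by (simp only: binomial_functional_def descend_def sum.distrib distrib_left)
qed

lemma binomial_functional_descent:
  "binomial_functional m ((descend ^^ d) g) = binomial_functional (m + d) g"
  by (induction d arbitrary: m) (simp_all add: binomial_functional_descend)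

text \<open>
  The coefficient of \<open>g b\<close> is a \<open>q\<close>-Vandermonde sum equal to \<open>gauss (m + n) (n + b)\<close>; together with
  the factor \<open>gauss (b + n) n\<close> of the link counts it becomes \<open>gauss (m + n) n * gauss m b\<close>.
\<close>

lemma binomial_functional_ascent:
  "binomial_functional m (\<lambda>a. \<Sum>b=0..a. q ^ ((a - b) choose 2) * gauss n (a - b) * gauss (b + n) n * g b)
     = gauss (m + n) n * binomial_functional m g"
proof -
  have exponent: "(Suc (b + r) choose 2) + (r choose 2) = (Suc b choose 2) + r * (b + r)" for b r
    by (induction r) (auto simp: numeral_2_eq_2 algebra_simps)
  have inner: "(\<Sum>a\<in>{a\<in>{..m}. b \<le> a}. q ^ (Suc a choose 2) * gauss m a * (q ^ ((a - b) choose 2) * gauss n (a - b)))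
      = q ^ (Suc b choose 2) * gauss (m + n) (n + b)" if "b \<le> m" for b
  proof -
    let ?f = "\<lambda>r. q ^ (Suc (b + r) choose 2) * gauss m (b + r) * (q ^ (r choose 2) * gauss n r)"
    have "(\<Sum>a\<in>{a\<in>{..m}. b \<le> a}. q ^ (Suc a choose 2) * gauss m a * (q ^ ((a - b) choose 2) * gauss n (a - b)))
        = (\<Sum>r\<le>m - b. ?f r)"
      using that by (intro sum.reindex_bij_witness[of _ "\<lambda>r. b + r" "\<lambda>a. a - b"]) auto
    also have "\<dots> = (\<Sum>r\<le>m + n. ?f r)"
      by (intro sum.mono_neutral_left) (auto simp: gauss_eq_0)
    also have "\<dots> = (\<Sum>r\<le>n. ?f r)"
      by (intro sum.mono_neutral_right) (auto simp: gauss_eq_0)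
    also have "\<dots> = (\<Sum>r\<le>n. q ^ (Suc b choose 2) * (q ^ (r * (b + r)) * gauss m (b + r) * gauss n r))"
    proof (intro sum.cong refl)
      fix r
      have "?f r = q ^ ((Suc (b + r) choose 2) + (r choose 2)) * (gauss m (b + r) * gauss n r)"
        by (simp only: power_add ac_simps)
      also have "\<dots> = q ^ (Suc b choose 2) * (q ^ (r * (b + r)) * gauss m (b + r) * gauss n r)"
        unfolding exponent by (simp only: power_add ac_simps)
      finally show "?f r = q ^ (Suc b choose 2) * (q ^ (r * (b + r)) * gauss m (b + r) * gauss n r)" .
    qed
    finally show ?thesis
      by (simp only: sum_distrib_left[symmetric] gauss_vandermonde_shifted)
  qed
  have "binomial_functional m (\<lambda>a. \<Sum>b=0..a. q ^ ((a - b) choose 2) * gauss n (a - b) * gauss (b + n) n * g b)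
      = (\<Sum>a\<in>{..m}. \<Sum>b\<in>{b\<in>{..m}. b \<le> a}. (gauss (b + n) n * g b)
          * (q ^ (Suc a choose 2) * gauss m a * (q ^ ((a - b) choose 2) * gauss n (a - b))))"
    unfolding binomial_functional_def
  proof (intro sum.cong refl)
    fix a assume "a \<in> {..m}"
    then have "{0..a} = {b\<in>{..m}. b \<le> a}" by auto
    then show "q ^ (Suc a choose 2) * gauss m a
          * (\<Sum>b=0..a. q ^ ((a - b) choose 2) * gauss n (a - b) * gauss (b + n) n * g b)
        = (\<Sum>b\<in>{b\<in>{..m}. b \<le> a}. (gauss (b + n) n * g b)
          * (q ^ (Suc a choose 2) * gauss m a * (q ^ ((a - b) choose 2) * gauss n (a - b))))"
      by (simp only: sum_distrib_left ac_simps)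
  qed
  also have "\<dots> = (\<Sum>b\<in>{..m}. \<Sum>a\<in>{a\<in>{..m}. b \<le> a}. (gauss (b + n) n * g b)
          * (q ^ (Suc a choose 2) * gauss m a * (q ^ ((a - b) choose 2) * gauss n (a - b))))"
    by (rule sum.swap_restrict) auto
  also have "\<dots> = (\<Sum>b\<in>{..m}. gauss (m + n) n * (q ^ (Suc b choose 2) * gauss m b * g b))"
  proof (intro sum.cong refl)
    fix b assume "b \<in> {..m}"
    then have "b \<le> m" by simp
    have "(\<Sum>a\<in>{a\<in>{..m}. b \<le> a}. (gauss (b + n) n * g b)
          * (q ^ (Suc a choose 2) * gauss m a * (q ^ ((a - b) choose 2) * gauss n (a - b))))
        = q ^ (Suc b choose 2) * (gauss (b + n) n * gauss (m + n) (n + b)) * g b"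
      unfolding sum_distrib_left[symmetric] inner[OF \<open>b \<le> m\<close>] by (simp only: ac_simps)
    then show "(\<Sum>a\<in>{a\<in>{..m}. b \<le> a}. (gauss (b + n) n * g b)
          * (q ^ (Suc a choose 2) * gauss m a * (q ^ ((a - b) choose 2) * gauss n (a - b))))
        = gauss (m + n) n * (q ^ (Suc b choose 2) * gauss m b * g b)"
      unfolding gauss_trinomial by (simp only: ac_simps)
  qed
  finally show ?thesis by (simp only: binomial_functional_def sum_distrib_left)
qed

text \<open>
  The ascent of a hill contributes a factor, and its descent advances \<open>m\<close> by the number of its steps.
\<close>

lemma transfer_zigzag:
  assumes "k \<ge> 1" and "\<And>i. i \<in> {1..l} \<Longrightarrow> n i > 0"
  shows "foldr transfer (zigzag_path k n l) g (0, 0)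
     = (\<Prod>j=1..l. gauss (k * (\<Sum>i=1..<j. n i) + n j) (n j))
       * binomial_functional (k * (\<Sum>i=1..l. n i)) (\<lambda>a. g (a, 0))"
  using assms(2)
proof (induction l arbitrary: g)
  case 0
  then show ?case by (simp add: zigzag_path_def binomial_functional_def numeral_2_eq_2)
next
  case (Suc l)
  define m where "m = k * (\<Sum>i=1..l. n i)"
  let ?n = "n (Suc l)"
  let ?C = "\<Prod>j=1..l. gauss (k * (\<Sum>i=1..<j. n i) + n j) (n j)"
  let ?G = "(descend ^^ (k * ?n)) (\<lambda>a. g (a, 0))"
  have d: "k * ?n > 0" using assms(1) Suc.prems[of "Suc l"] by simp
  have "foldr transfer (zigzag_path k n (Suc l)) g (0, 0)
      = foldr transfer (zigzag_path k n l) ((transfer Up ^^ ?n) (?G \<circ> fst)) (0, 0)"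
    by (simp only: zigzag_path_Suc foldr_append foldr_replicate o_apply transfer_descent[OF d])
  also have "\<dots> = ?C * binomial_functional m (\<lambda>a. (transfer Up ^^ ?n) (?G \<circ> fst) (a, 0))"
    unfolding m_def using Suc.prems by (intro Suc.IH) simp
  also have "\<dots> = ?C * (gauss (m + ?n) ?n * binomial_functional (m + k * ?n) (\<lambda>a. g (a, 0)))"
    by (simp only: transfer_ascent[OF le0] minus_nat.diff_0 binomial_functional_ascent
        binomial_functional_descent)
  also have "m + k * ?n = k * (\<Sum>i=1..Suc l. n i)"
    by (simp add: m_def distrib_left)
  also have "?C * (gauss (m + ?n) ?n * binomial_functional (k * (\<Sum>i=1..Suc l. n i)) (\<lambda>a. g (a, 0)))
      = (?C * gauss (k * (\<Sum>i=1..<Suc l. n i) + ?n) ?n)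
        * binomial_functional (k * (\<Sum>i=1..Suc l. n i)) (\<lambda>a. g (a, 0))"
    by (simp only: m_def atLeastLessThanSuc_atLeastAtMost mult.assoc)
  also have "?C * gauss (k * (\<Sum>i=1..<Suc l. n i) + ?n) ?n
      = (\<Prod>j=1..Suc l. gauss (k * (\<Sum>i=1..<j. n i) + n j) (n j))"
    by simp
  finally show ?case .
qed

section \<open>Paths and cells in diagonal coordinates\<close>

text \<open>
  The number of up steps determines the \<open>i\<close>-th point of a path, whose coordinates have sum \<open>i\<close>.
\<close>

definition ups :: "step list \<Rightarrow> nat \<Rightarrow> nat" where
  "ups p i = count_list (take i p) Up"

lemma ups_0 [simp]: "ups p 0 = 0"
  by (simp add: ups_def)

lemma ups_Suc: "i < length p \<Longrightarrow> ups p (Suc i) = ups p i + (if p ! i = Up then 1 else 0)"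
  by (simp add: ups_def take_Suc_conv_app_nth)

lemma ups_add: "ups p (i + d) = ups p i + ups (drop i p) d"
  by (simp add: ups_def take_add)

lemma ups_le: "ups p d \<le> d"
  using count_list_steps[of "take d p"] by (simp add: ups_def)

lemma ups_mono: "i \<le> j \<Longrightarrow> ups p i \<le> ups p j"
  using ups_add[of p i "j - i"] by simp

lemma ups_le_add_diff: "i \<le> j \<Longrightarrow> ups p j \<le> ups p i + (j - i)"
  using ups_add[of p i "j - i"] ups_le[of "drop i p" "j - i"] by simp

lemma ups_eq_add_card:
  assumes "a \<le> b" "b \<le> length p"
  shows "ups p b = ups p a + card {u\<in>{a..<b}. p ! u = Up}"
  using assms
proof (induction b rule: dec_induct)
  case (step b)
  have "{u\<in>{a..<Suc b}. p ! u = Up} = {u\<in>{a..<b}. p ! u = Up} \<union> (if p ! b = Up then {b} else {})"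
    using step by (auto simp: less_Suc_eq)
  then show ?case using step by (simp add: ups_Suc)
qed simp

lemma path_point_eq:
  "i \<le> length p \<Longrightarrow> path_point p i = (int i - int (ups p i), int (ups p i))"
  using path_point_sum[of i p] by (simp add: path_point_def ups_def)

text \<open>
  A path meets each antidiagonal once, so a cell whose lower right and upper left corners lie on the
  \<open>i\<close>-th antidiagonal needs to be compared with the \<open>i\<close>-th point only.
\<close>

lemma cell_above_iff:
  assumes "i \<le> length p" "a + b + 1 = int i"
  shows "cell_above p (a, b) \<longleftrightarrow> int (ups p i) \<le> b"
proof
  assume "cell_above p (a, b)"
  then obtain i' where i': "i' \<le> length p" "a + 1 \<le> int i' - int (ups p i')" "int (ups p i') \<le> b"
    by (auto simp: cell_above_def path_points_def path_point_eq)
  show "int (ups p i) \<le> b"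
    using ups_mono[of i i' p] ups_le_add_diff[of i' i p] i' assms by (cases "i \<le> i'") linarith+
next
  assume "int (ups p i) \<le> b"
  then have "a + 1 \<le> fst (path_point p i)" "snd (path_point p i) \<le> b"
    using assms by (auto simp: path_point_eq)
  then show "cell_above p (a, b)"
    using assms(1) unfolding cell_above_def path_points_def
    by (auto simp: case_prod_beta intro!: bexI[of _ i])
qed

lemma cell_below_iff:
  assumes "i \<le> length p" "a + b + 1 = int i"
  shows "cell_below p (a, b) \<longleftrightarrow> b + 1 \<le> int (ups p i)"
proof
  assume "cell_below p (a, b)"
  then obtain i' where i': "i' \<le> length p" "int i' - int (ups p i') \<le> a" "b + 1 \<le> int (ups p i')"
    by (auto simp: cell_below_def path_points_def path_point_eq)
  show "b + 1 \<le> int (ups p i)"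
    using ups_mono[of i' i p] ups_le_add_diff[of i i' p] i' assms by (cases "i \<le> i'") linarith+
next
  assume "b + 1 \<le> int (ups p i)"
  then have "fst (path_point p i) \<le> a" "b + 1 \<le> snd (path_point p i)"
    using assms by (auto simp: path_point_eq)
  then show "cell_below p (a, b)"
    using assms(1) unfolding cell_below_def path_points_def
    by (auto simp: case_prod_beta intro!: bexI[of _ i])
qed

text \<open>
  The quantity \<open>ky - x\<close> at the \<open>i\<close>-th point \<open>(x, y)\<close>, which has to stay nonnegative along a
  \<open>k\<close>-Dyck path.
\<close>

definition height :: "nat \<Rightarrow> step list \<Rightarrow> nat \<Rightarrow> int" where
  "height k p i = (int k + 1) * int (ups p i) - int i"

lemma height_Suc:
  "i < length p \<Longrightarrow> height k p (Suc i) = height k p i + (if p ! i = Up then int k else - 1)"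
  by (simp add: height_def ups_Suc algebra_simps)

lemma kdyck_path_iff:
  "kdyck_path k n p \<longleftrightarrow> length p = (k + 1) * n \<and> ups p (length p) = n
     \<and> (\<forall>i\<le>length p. 0 \<le> height k p i)"
proof -
  have "path_point p (length p) = (int (k * n), int n) \<longleftrightarrow> length p = (k + 1) * n \<and> ups p (length p) = n"
  proof -
    have "(int l - int u = int x \<and> int u = int n) \<longleftrightarrow> (l = x + n \<and> u = n)" for l u x by linarith
    moreover have "(k + 1) * n = k * n + n" by simp
    ultimately show ?thesis by (simp only: path_point_eq[OF order_refl] prod.inject)
  qed
  moreover have "(\<forall>(x, y) \<in> path_points p. x \<le> int k * y) \<longleftrightarrow> (\<forall>i\<le>length p. 0 \<le> height k p i)"
    by (auto simp: path_points_def path_point_eq height_def algebra_simps)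
  ultimately show ?thesis by (auto simp: kdyck_path_def)
qed

text \<open>
  The cell at level \<open>j\<close> over the \<open>i\<close>-th point of \<open>p\<close>: the cells at level \<open>j\<close> are the points of \<open>p\<close>
  translated by \<open>(-j, j - 1)\<close>.  Level \<open>1\<close> touches the path from above and level \<open>0\<close> from below.
\<close>

definition lcell :: "step list \<Rightarrow> nat \<Rightarrow> nat \<Rightarrow> cell" where
  "lcell p j i = (int i - int (ups p i) - int j, int (ups p i) + int j - 1)"

lemma lcell_eq_iff [simp]: "lcell p j i = lcell p j' i' \<longleftrightarrow> j = j' \<and> i = i'"
proof
  assume eq: "lcell p j i = lcell p j' i'"
  have "fst (lcell p j i) + snd (lcell p j i) = int i - 1" for i j by (simp add: lcell_def)
  with eq have "i = i'" by (metis add_diff_cancel_right' diff_add_cancel of_nat_eq_iff)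
  with eq show "j = j' \<and> i = i'" by (simp add: lcell_def)
qed simp

lemma lcell_image_iff [simp]: "lcell p j i \<in> lcell p j' ` A \<longleftrightarrow> j = j' \<and> i \<in> A"
  by auto

lemma translate_lcell:
  "translate (1, -1) (lcell p (Suc j) ` A) = lcell p j ` A"
  unfolding translate_def image_image by (intro image_cong) (auto simp: lcell_def)

lemma cell_below_lcell_iff: "i \<le> length p \<Longrightarrow> cell_below p (lcell p j i) \<longleftrightarrow> j = 0"
  unfolding lcell_def by (subst cell_below_iff[of i]) auto

lemma height_end: "kdyck_path k n p \<Longrightarrow> height k p (length p) = 0"
proof -
  assume "kdyck_path k n p"
  then have "length p = (k + 1) * n" "ups p (length p) = n" by (auto simp only: kdyck_path_iff)
  then show ?thesis by (simp add: height_def algebra_simps)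
qed

lemma ex_lcell:
  assumes "a + b + 1 = int i" "int (ups p i) \<le> b"
  obtains j where "(a, b) = lcell p j i" "1 \<le> j"
proof
  show "(a, b) = lcell p (nat (b + 1 - int (ups p i))) i" "1 \<le> nat (b + 1 - int (ups p i))"
    using assms by (auto simp: lcell_def)
qed

section \<open>Dyck segments and arches\<close>

text \<open>
  The maximal run of consecutive positions around \<open>p\<close>, where \<open>i \<in> J\<close> means that the positions
  \<open>i\<close> and \<open>Suc i\<close> are linked.
\<close>

definition component :: "nat set \<Rightarrow> nat \<Rightarrow> nat set" where
  "component J p = {s. \<forall>i. min s p \<le> i \<and> i < max s p \<longrightarrow> i \<in> J}"

lemma self_in_component [simp]: "p \<in> component J p"
  by (auto simp: component_def)

lemma component_mono: "J \<subseteq> J' \<Longrightarrow> component J p \<subseteq> component J' p"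
  by (auto simp: component_def)

text \<open>
  Lying in a common run is transitive: a link between \<open>x\<close> and \<open>z\<close> lies between \<open>x\<close> and \<open>y\<close> or
  between \<open>y\<close> and \<open>z\<close>.
\<close>

lemma component_eq:
  assumes "s \<in> component J p"
  shows "component J s = component J p"
proof -
  have split: "i \<in> J" if "\<forall>i. min x y \<le> i \<and> i < max x y \<longrightarrow> i \<in> J"
    "\<forall>i. min y z \<le> i \<and> i < max y z \<longrightarrow> i \<in> J" "min x z \<le> i" "i < max x z" for x y z i :: nat
  proof -
    have "(min x y \<le> i \<and> i < max x y) \<or> (min y z \<le> i \<and> i < max y z)"
      using that(3,4) by linarith
    then show ?thesis using that(1,2) by blast
  qed
  have sp: "\<forall>i. min s p \<le> i \<and> i < max s p \<longrightarrow> i \<in> J"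
    and ps: "\<forall>i. min p s \<le> i \<and> i < max p s \<longrightarrow> i \<in> J"
    using assms by (auto simp: component_def min.commute max.commute)
  show ?thesis
  proof (intro equalityI subsetI)
    fix t assume "t \<in> component J s"
    then have ts: "\<forall>i. min t s \<le> i \<and> i < max t s \<longrightarrow> i \<in> J" by (simp add: component_def)
    show "t \<in> component J p" using split[OF ts sp] by (simp add: component_def)
  next
    fix t assume "t \<in> component J p"
    then have tp: "\<forall>i. min t p \<le> i \<and> i < max t p \<longrightarrow> i \<in> J" by (simp add: component_def)
    show "t \<in> component J s" using split[OF tp ps] by (simp add: component_def)
  qed
qed

lemma Suc_in_component_iff: "Suc p \<in> component J p \<longleftrightarrow> p \<in> J"
  by (auto simp: component_def less_Suc_eq)

lemma component_interval:
  assumes "p \<le> n" and J: "\<And>i. i \<in> J \<Longrightarrow> i < n"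
  obtains a b where "a \<le> p" "p \<le> b" "b \<le> n" "component J p = {a..b}"
    "{a..<b} \<subseteq> J" "a = 0 \<or> a - 1 \<notin> J" "b \<notin> J"
proof -
  define b where "b = (LEAST b. p \<le> b \<and> b \<notin> J)"
  have b: "p \<le> b \<and> b \<notin> J" unfolding b_def by (rule LeastI[of _ n]) (use assms in auto)
  have b_min: "i \<in> J" if "p \<le> i" "i < b" for i
    using not_less_Least[of i "\<lambda>b. p \<le> b \<and> b \<notin> J"] that unfolding b_def by blast
  have "b \<le> n" unfolding b_def by (rule Least_le) (use assms in auto)
  define a where "a = (LEAST a. {a..<p} \<subseteq> J)"
  have a: "{a..<p} \<subseteq> J" unfolding a_def by (rule LeastI[of _ p]) simp
  have a_min: "a \<le> i" if "{i..<p} \<subseteq> J" for i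
    using that unfolding a_def by (rule Least_le)
  have "a \<le> p" by (rule a_min) simp
  have "component J p = {a..b}"
  proof (intro equalityI subsetI)
    fix s assume s: "s \<in> component J p"
    have "s \<le> b"
    proof (rule ccontr)
      assume "\<not> s \<le> b"
      then have "b \<in> J" using s b by (auto simp: component_def)
      then show False using b by simp
    qed
    moreover have "a \<le> s"
    proof (cases "s \<le> p")
      case True
      then have "{s..<p} \<subseteq> J" using s by (auto simp: component_def)
      then show ?thesis by (rule a_min)
    qed (use \<open>a \<le> p\<close> in simp)
    ultimately show "s \<in> {a..b}" by simp
  next
    fix s assume "s \<in> {a..b}"
    then have "i \<in> J" if "min s p \<le> i" "i < max s p" for i
      using a b_min[of i] that by (cases "i < p") (auto simp: subset_iff)
    then show "s \<in> component J p" by (simp add: component_def)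
  qed
  moreover have "{a..<b} \<subseteq> J" using a b_min by (metis atLeastLessThan_iff not_le subset_iff)
  moreover have "a = 0 \<or> a - 1 \<notin> J"
  proof (rule ccontr)
    assume "\<not> (a = 0 \<or> a - 1 \<notin> J)"
    then have "a > 0" "a - 1 \<in> J" by auto
    moreover have "{a - 1..<p} \<subseteq> insert (a - 1) {a..<p}" by auto
    ultimately have "{a - 1..<p} \<subseteq> J" "a > 0" using a by blast+
    then show False using a_min[of "a - 1"] by simp
  qed
  ultimately show ?thesis using that \<open>a \<le> p\<close> b \<open>b \<le> n\<close> by blast
qed

locale lower_path =
  fixes k :: nat and lam :: "step list" and N :: nat
  assumes kdyck: "kdyck_path k N lam"
begin

abbreviation "ht \<equiv> height k lam"
abbreviation "lc \<equiv> lcell lam"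

lemma ht_end: "ht (length lam) = 0"
    using kdyck by (rule height_end)

lemma ht_nonneg: "i \<le> length lam \<Longrightarrow> 0 \<le> ht i"
  using kdyck by (simp add: kdyck_path_iff)

text \<open>
  Both paths end at the same point, so no cell outside the antidiagonals that meet \<open>\<lambda>\<close> satisfies
  \<open>cell_above\<close> and \<open>cell_below\<close> at the same time.
\<close>

lemma region_between_eq:
  assumes "kdyck_path k M mu" "length mu = length lam"
  shows "region_between lam mu =
    {lc j i | j i. i \<le> length lam \<and> 1 \<le> j \<and> ups lam i + j \<le> ups mu i}"
proof (intro equalityI subsetI)
  fix c assume c: "c \<in> region_between lam mu"
  obtain a b where ab: "c = (a, b)" by (cases c)
  obtain i where i: "i \<le> length lam" "a + 1 \<le> int i - int (ups lam i)" "int (ups lam i) \<le> b"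
    using c by (auto simp: ab region_between_def cell_above_def path_points_def path_point_eq)
  obtain i' where i': "i' \<le> length mu" "int i' - int (ups mu i') \<le> a" "b + 1 \<le> int (ups mu i')"
    using c by (auto simp: ab region_between_def cell_below_def path_points_def path_point_eq)
  have ends: "ups mu (length lam) = ups lam (length lam)"
  proof -
    have "(k + 1) * ups mu (length lam) = (k + 1) * ups lam (length lam)"
      using assms kdyck by (metis kdyck_path_iff)
    then show ?thesis by (simp only: mult_cancel1) simp
  qed
  have "a + b + 2 \<le> int (length lam)"
    using ups_le_add_diff[OF i(1), of lam] ups_mono[of i' "length lam" mu] i i' ends assms(2) by linarith
  moreover have "0 \<le> a" "0 \<le> b" using i i' ups_le[of mu i'] by linarith+
  ultimately have "a + b + 1 = int (nat (a + b + 1))" "nat (a + b + 1) \<le> length lam" by linarith+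
  then obtain p where p: "a + b + 1 = int p" "p \<le> length lam" by blast
  have "int (ups lam p) \<le> b" "b + 1 \<le> int (ups mu p)"
    using c p assms(2) cell_above_iff[of p lam a b] cell_below_iff[of p mu a b]
    by (auto simp: ab region_between_def)
  moreover from this(1) obtain j where "(a, b) = lc j p" "1 \<le> j" by (rule ex_lcell[OF p(1)])
  ultimately show "c \<in> {lc j i | j i. i \<le> length lam \<and> 1 \<le> j \<and> ups lam i + j \<le> ups mu i}"
    using p(2) unfolding ab by (intro CollectI exI[of _ j] exI[of _ p]) (simp add: lcell_def)
next
  fix c assume "c \<in> {lc j i | j i. i \<le> length lam \<and> 1 \<le> j \<and> ups lam i + j \<le> ups mu i}"
  then obtain i j where c: "c = lc j i" "i \<le> length lam" "1 \<le> j" "ups lam i + j \<le> ups mu i" by blast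
  then show "c \<in> region_between lam mu"
    using assms(2) cell_above_iff[of i lam] cell_below_iff[of i mu]
    by (simp add: region_between_def lcell_def)
qed

text \<open>
  The steps of \<open>\<lambda>\<close> from position \<open>a\<close> to position \<open>b\<close> form, up to translation, a \<open>k\<close>-Dyck path.
\<close>

definition dyck_segment :: "nat \<Rightarrow> nat \<Rightarrow> bool" where
  "dyck_segment a b \<longleftrightarrow> a \<le> b \<and> b \<le> length lam \<and> ht a = ht b \<and> (\<forall>s\<in>{a..b}. ht a \<le> ht s)"

lemma kdyck_tile_segment:
  assumes "dyck_segment a b"
  shows "kdyck_tile k (lc j ` {a..b})"
proof -
  define p where "p = take (b - a) (drop a lam)"
  have ab: "a \<le> b" "b \<le> length lam" using assms by (auto simp: dyck_segment_def)
  have len: "length p = b - a" using ab by (simp add: p_def)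
  have ups_p: "ups p i = ups (drop a lam) i" if "i \<le> b - a" for i
    using that by (simp add: p_def ups_def min_absorb1)
  have ht_p: "height k p i = ht (a + i) - ht a" if "i \<le> b - a" for i
    using that by (simp add: height_def ups_p ups_add algebra_simps)
  have "kdyck_path k (ups p (length p)) p"
  proof -
    have "height k p (length p) = 0" using ht_p[of "b - a"] assms ab by (simp add: len dyck_segment_def)
    then have "int (length p) = int ((k + 1) * ups p (length p))"
      by (simp only: height_def of_nat_mult of_nat_add) simp
    moreover have "0 \<le> height k p i" if "i \<le> length p" for i
      using ht_p[of i] that assms by (auto simp: len dyck_segment_def)
    ultimately show ?thesis unfolding kdyck_path_iff by (simp only: of_nat_eq_iff) blast
  qed
  moreover have "lc j ` {a..b} = translate (lc j a) (path_points p)"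
  proof -
    have "{a..b} = (\<lambda>i. a + i) ` {..b - a}"
      using ab by (simp add: image_add_atLeastAtMost atMost_atLeast0)
    moreover have "lc j (a + i) = (\<lambda>(x, y). (x + fst (lc j a), y + snd (lc j a))) (path_point p i)"
      if "i \<le> b - a" for i
      using that by (simp add: path_point_eq len ups_p lcell_def ups_add)
    ultimately show ?thesis
      unfolding translate_def path_points_def len by (simp add: image_image)
  qed
  ultimately show ?thesis unfolding kdyck_tile_def by blast
qed

text \<open>
  Both the tile and the cells of level \<open>j\<close> contain at most one cell on each antidiagonal, and the
  tile meets consecutive antidiagonals.
\<close>

lemma segment_of_kdyck_tile:
  assumes "kdyck_tile k \<eta>" and "\<And>c. c \<in> \<eta> \<Longrightarrow> \<exists>i\<le>length lam. c = lc j i"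
  obtains a b where "dyck_segment a b" "\<eta> = lc j ` {a..b}"
proof -
  obtain n p v where p: "kdyck_path k n p" "\<eta> = translate v (path_points p)"
    using assms(1) by (auto simp: kdyck_tile_def)
  have point: "\<exists>g\<le>length lam. fst v + int i - int (ups p i) = int g - int (ups lam g) - int j
      \<and> snd v + int (ups p i) = int (ups lam g) + int j - 1" if "i \<le> length p" for i
  proof -
    have "(int i - int (ups p i) + fst v, int (ups p i) + snd v) \<in> \<eta>"
      using that unfolding p(2) translate_def path_points_def
      by (force simp: path_point_eq)
    from assms(2)[OF this] show ?thesis by (auto simp: lcell_def algebra_simps)
  qed
  obtain a where a: "a \<le> length lam" "fst v = int a - int (ups lam a) - int j"
    "snd v = int (ups lam a) + int j - 1"
    using point[of 0] by auto
  have pt: "a + i \<le> length lam \<and> ups lam (a + i) = ups lam a + ups p i" if i: "i \<le> length p" for i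
  proof -
    obtain g where g: "g \<le> length lam" "fst v + int i - int (ups p i) = int g - int (ups lam g) - int j"
       "snd v + int (ups p i) = int (ups lam g) + int j - 1"
      using point[OF i] by blast
    have "g = a + i" using a g by linarith
    moreover have "int (ups lam g) = int (ups lam a) + int (ups p i)" using a g by linarith
    ultimately show ?thesis using g(1) by (metis of_nat_add of_nat_eq_iff)
  qed
  have ht_p: "ht (a + i) = ht a + height k p i" if "i \<le> length p" for i
    using pt[OF that] by (simp add: height_def algebra_simps)
  have "height k p (length p) = 0" using p(1) by (rule height_end)
  then have "ht (a + length p) = ht a" using ht_p[of "length p"] by simp
  moreover have "ht a \<le> ht s" if "s \<in> {a..a + length p}" for s
    using ht_p[of "s - a"] that p(1) by (auto simp: kdyck_path_iff)
  ultimately have "dyck_segment a (a + length p)"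
    using pt[of "length p"] by (simp add: dyck_segment_def)
  moreover have "\<eta> = lc j ` {a..a + length p}"
  proof -
    have "{a..a + length p} = (\<lambda>i. a + i) ` {..length p}"
      by (simp add: image_add_atLeastAtMost atMost_atLeast0)
    moreover have "lc j (a + i) = (\<lambda>(x, y). (x + fst v, y + snd v)) (path_point p i)"
      if "i \<le> length p" for i
      using pt[OF that] a that by (simp add: path_point_eq lcell_def)
    ultimately show ?thesis
      unfolding p(2) translate_def path_points_def by (simp add: image_image)
  qed
  ultimately show ?thesis by (rule that)
qed

text \<open>
  The step \<open>p\<close> lies under the arch that starts with the up step \<open>u\<close> and ends where the path first
  returns to the height at which \<open>u\<close> starts.
\<close>

definition covers :: "nat \<Rightarrow> nat \<Rightarrow> bool" where
  "covers u p \<longleftrightarrow> u \<le> p \<and> p < length lam \<and> lam ! u = Up \<and> (\<forall>s. u < s \<and> s \<le> p \<longrightarrow> ht u < ht s)"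

lemma covers_refl: "u < length lam \<Longrightarrow> lam ! u = Up \<Longrightarrow> covers u u"
  by (simp add: covers_def)

text \<open>
  \<open>J\<close> is a union of arches.
\<close>

definition arch_closed :: "nat set \<Rightarrow> bool" where
  "arch_closed J \<longleftrightarrow> (\<forall>u\<in>J. \<forall>p. covers u p \<longrightarrow> p \<in> J) \<and> (\<forall>p\<in>J. \<exists>u\<in>J. covers u p)"

lemma arch_closed_less: "arch_closed J \<Longrightarrow> i \<in> J \<Longrightarrow> i < length lam"
  by (auto simp: arch_closed_def covers_def)

text \<open>
  If the run went below its initial height or ended above it, the arch responsible for the excursion
  would stick out of the run on the left or on the right.
\<close>

lemma dyck_segment_of_run:
  assumes J: "arch_closed J" and ab: "a \<le> b" "b \<le> length lam" "{a..<b} \<subseteq> J"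
    and left: "a = 0 \<or> a - 1 \<notin> J" and right: "b \<notin> J"
  shows "dyck_segment a b"
proof -
  have low: "ht a \<le> ht s" if "a \<le> s" "s \<le> b" for s
    using that
  proof (induction s rule: less_induct)
    case (less s)
    show ?case
    proof (cases "s = a")
      case False
      then have s: "a < s" using less.prems by simp
      then have "s - 1 \<in> {a..<b}" using less.prems by auto
      then have "s - 1 \<in> J" using ab(3) by blast
      then obtain u where u: "u \<in> J" "covers u (s - 1)" using J by (auto simp: arch_closed_def)
      have "a \<le> u"
      proof (rule ccontr)
        assume "\<not> a \<le> u"
        then have "covers u (a - 1)" "a \<noteq> 0" using u(2) s(1) by (auto simp: covers_def)
        then show False using J u(1) left by (auto simp: arch_closed_def)
      qed
      moreover have "u < s" using u(2) s(1) by (auto simp: covers_def)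
      ultimately have "ht a \<le> ht u" using less by simp
      moreover have "ht u \<le> ht s"
      proof -
        have "s - 1 < length lam" "Suc (s - 1) = s" using u(2) s(1) by (auto simp: covers_def)
        then have step: "ht s = ht (s - 1) + (if lam ! (s - 1) = Up then int k else - 1)"
          using height_Suc[of "s - 1" lam k] by simp
        show ?thesis
        proof (cases "u = s - 1")
          case True
          then show ?thesis using step u(2) by (simp add: covers_def)
        next
          case False
          then have "ht u < ht (s - 1)" using u(2) by (auto simp: covers_def)
          then show ?thesis using step by (simp split: if_splits)
        qed
      qed
      ultimately show ?thesis by simp
    qed simp
  qed
  have "ht b \<le> ht a"
  proof (rule ccontr)
    assume b: "\<not> ht b \<le> ht a"
    (* the last position not above the initial height starts an arch reaching beyond b *)
    define u where "u = Max {u\<in>{a..b}. ht u \<le> ht a}"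
    have "u \<in> {u\<in>{a..b}. ht u \<le> ht a}" unfolding u_def by (rule Max_in) (use ab in auto)
    then have u: "a \<le> u" "u \<le> b" "ht u \<le> ht a" by auto
    have above: "ht a < ht s" if "u < s" "s \<le> b" for s
    proof (rule ccontr)
      assume "\<not> ht a < ht s"
      then have "s \<le> u" unfolding u_def using that u by (intro Max_ge) auto
      then show False using that by simp
    qed
    have "u < b" using u b by (cases "u = b") auto
    then have "u \<in> J" "u < length lam" using ab u by auto
    have "ht u < ht (Suc u)" using above[of "Suc u"] \<open>u < b\<close> u by simp
    then have "lam ! u = Up" using height_Suc[OF \<open>u < length lam\<close>, of k] by (auto split: if_splits)
    have "b \<noteq> length lam"
      using b ht_end ht_nonneg[of a] ab by auto
    then have "covers u b"
      using u ab \<open>lam ! u = Up\<close> above by (fastforce simp: covers_def)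
    then show False using J \<open>u \<in> J\<close> right by (auto simp: arch_closed_def)
  qed
  then show ?thesis using low[of b] low ab by (force simp: dyck_segment_def)
qed

lemma dyck_segment_covers_inside:
  assumes "dyck_segment a b" "a \<le> u" "u < b" "covers u p"
  shows "p < b"
proof (rule ccontr)
  assume "\<not> p < b"
  then have "ht u < ht b" using assms by (auto simp: covers_def)
  moreover have "ht b \<le> ht u" using assms unfolding dyck_segment_def by (metis atLeastAtMost_iff less_imp_le)
  ultimately show False by simp
qed

text \<open>
  For a down step, the last earlier position of the segment that is not higher than the end of the
  step starts an arch over it.
\<close>

lemma dyck_segment_covered:
  assumes "dyck_segment a b" "a \<le> p" "p < b"
  obtains u where "a \<le> u" "u \<le> p" "covers u p"
proof (cases "lam ! p = Up")
  case True
  then show ?thesis using that[of p] assms by (simp add: covers_refl dyck_segment_def)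
next
  case False
  have p: "p < length lam" using assms by (simp add: dyck_segment_def)
  have drop: "ht (Suc p) = ht p - 1" using False height_Suc[OF p, of k] by simp
  have a: "ht a \<le> ht (Suc p)" using assms unfolding dyck_segment_def by (metis Suc_leI atLeastAtMost_iff le_SucI)
  define u where "u = Max {u\<in>{a..p}. ht u \<le> ht (Suc p)}"
  have "u \<in> {u\<in>{a..p}. ht u \<le> ht (Suc p)}"
    unfolding u_def by (rule Max_in) (use assms a in auto)
  then have u: "a \<le> u" "u \<le> p" "ht u \<le> ht (Suc p)" by auto
  have above: "ht (Suc p) < ht s" if "u < s" "s \<le> p" for s
  proof (rule ccontr)
    assume "\<not> ht (Suc p) < ht s"
    then have "s \<le> u" unfolding u_def using that u by (intro Max_ge) auto
    then show False using that by simp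
  qed
  have "u \<noteq> p" using u drop by auto
  then have "ht u < ht (Suc u)" using above[of "Suc u"] u by simp
  then have "lam ! u = Up" using height_Suc[of u lam k] u p by (auto split: if_splits)
  then have "covers u p" using u p above by (fastforce simp: covers_def)
  then show ?thesis using that u by blast
qed

end

section \<open>Tilings as height and link profiles\<close>

text \<open>
  This turns the set of levels at which an up step lies inside a tile into a number.
\<close>

lemma down_closed_eq_atLeastAtMost_card:
  fixes A :: "nat set"
  assumes down: "\<And>j. 1 \<le> j \<Longrightarrow> Suc j \<in> A \<Longrightarrow> j \<in> A" and bound: "A \<subseteq> {1..m}"
  shows "A = {1..card A}"
proof (cases "A = {}")
  case False
  have fin: "finite A" using bound by (rule finite_subset) simp
  have "Max A \<in> A" using fin False by (rule Max_in)
  have "j \<in> A" if "j \<le> Max A" "1 \<le> j" for j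
    using that
  proof (induction j rule: inc_induct)
    case (step j)
    then have "Suc j \<in> A" by simp
    with step.prems show ?case by (rule down)
  qed (rule \<open>Max A \<in> A\<close>)
  then have "{1..Max A} \<subseteq> A" by (meson atLeastAtMost_iff subsetI)
  moreover have "A \<subseteq> {1..Max A}" using fin bound by (meson Max_ge atLeastAtMost_iff subset_iff)
  ultimately have "A = {1..Max A}" by (rule subset_antisym[rotated])
  then have "card A = Max A" by (metis card_atLeastAtMost diff_Suc_1)
  with \<open>A = {1..Max A}\<close> show ?thesis by metis
qed simp

context lower_path
begin

text \<open>
  The conditions on the first three lines say that \<open>h\<close> is the distance along the antidiagonals
  between \<open>\<lambda>\<close> and some path above it.  The last condition says that at each level \<open>j\<close> the arches of the up steps with
  \<open>j \<le> c u\<close> consist of cells of the region, and that the set of these up steps is closed under passing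
  to up steps below the arches.
\<close>

definition is_profile :: "(nat \<Rightarrow> nat) \<Rightarrow> (nat \<Rightarrow> nat) \<Rightarrow> bool" where
  "is_profile h c \<longleftrightarrow>
     h 0 = 0 \<and> (\<forall>p\<ge>length lam. h p = 0) \<and>
     (\<forall>p<length lam. if lam ! p = Up then h p = h (Suc p) \<or> h p = Suc (h (Suc p))
                                      else h (Suc p) = h p \<or> h (Suc p) = Suc (h p)) \<and>
     (\<forall>u. c u \<noteq> 0 \<longrightarrow> u < length lam \<and> lam ! u = Up) \<and>
     (\<forall>u p. covers u p \<longrightarrow> c u \<le> h p \<and> c u \<le> h (Suc p) \<and> (lam ! p = Up \<longrightarrow> c u \<le> c p))"

text \<open>
  The steps both of whose end points lie in the same tile of level \<open>j\<close>.
\<close>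

definition joined :: "(nat \<Rightarrow> nat) \<Rightarrow> nat \<Rightarrow> nat set" where
  "joined c j = {p. \<exists>u. covers u p \<and> j \<le> c u}"

definition tiling_of :: "(nat \<Rightarrow> nat) \<Rightarrow> (nat \<Rightarrow> nat) \<Rightarrow> cell set set" where
  "tiling_of h c = {lc j ` component (joined c j) p | j p. p \<le> length lam \<and> 1 \<le> j \<and> j \<le> h p}"

end

text \<open>
  From a given tiling, \<open>h\<close>, \<open>J\<close> and \<open>c\<close> read off the number of cells over each position, the steps
  inside tiles of each level, and the number of levels at which an up step is inside a tile.
\<close>

locale tiled_path = lower_path +
  fixes mu :: "step list" and D :: "cell set set"
  assumes mu: "kdyck_path k N mu" and above: "weakly_above mu lam"
    and tiling: "kdyck_tiling k lam mu D"
begin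

definition h :: "nat \<Rightarrow> nat" where
  "h i = ups mu i - ups lam i"

definition J :: "nat \<Rightarrow> nat set" where
  "J j = {p. \<exists>\<eta>\<in>D. lc j p \<in> \<eta> \<and> lc j (Suc p) \<in> \<eta>}"

definition c :: "nat \<Rightarrow> nat" where
  "c u = (if u < length lam \<and> lam ! u = Up then card {j. u \<in> J j} else 0)"

lemma length_mu: "length mu = length lam"
  using above by (simp add: weakly_above_def)

lemma ups_mu: "i \<le> length lam \<Longrightarrow> ups mu i = ups lam i + h i"
  using above length_mu by (auto simp: weakly_above_def path_point_eq h_def)

lemma union_tiles: "\<Union>D = {lc j i | j i. i \<le> length lam \<and> 1 \<le> j \<and> j \<le> h i}"
proof -
  have "\<Union>D = region_between lam mu"
    using tiling by (simp add: kdyck_tiling_def partition_on_def)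
  also have "\<dots> = {lc j i | j i. i \<le> length lam \<and> 1 \<le> j \<and> j \<le> h i}"
    unfolding region_between_eq[OF mu length_mu] by (intro Collect_cong) (auto simp: ups_mu)
  finally show ?thesis .
qed

lemma tile_cell:
  assumes "\<eta> \<in> D" "x \<in> \<eta>"
  obtains j i where "x = lc j i" "i \<le> length lam" "1 \<le> j" "j \<le> h i"
proof -
  have "x \<in> \<Union>D" using assms by (rule UnionI)
  then show ?thesis unfolding union_tiles using that by blast
qed

lemma lcell_in_tile_bounds:
  "\<eta> \<in> D \<Longrightarrow> lc j i \<in> \<eta> \<Longrightarrow> i \<le> length lam \<and> 1 \<le> j \<and> j \<le> h i"
proof -
  assume "\<eta> \<in> D" "lc j i \<in> \<eta>"
  then obtain j' i' where "lc j i = lc j' i'" "i' \<le> length lam" "1 \<le> j'" "j' \<le> h i'"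
    by (rule tile_cell)
  then show ?thesis by simp
qed

lemma tiles_disjoint: "\<eta> \<in> D \<Longrightarrow> \<theta> \<in> D \<Longrightarrow> x \<in> \<eta> \<Longrightarrow> x \<in> \<theta> \<Longrightarrow> \<eta> = \<theta>"
  using tiling by (auto simp: kdyck_tiling_def partition_on_def disjoint_def)

text \<open>
  Induction on the level of one of the cells.  If the translate of the tile is below \<open>\<lambda>\<close>, then all
  its cells have level \<open>1\<close>.  Otherwise the translate lies inside another tile, which has a cell of
  smaller level and therefore constant level.
\<close>

lemma tile_constant_level:
  "\<eta> \<in> D \<Longrightarrow> lc j i \<in> \<eta> \<Longrightarrow> x \<in> \<eta> \<Longrightarrow> \<exists>i'\<le>length lam. x = lc j i'"
proof (induction j arbitrary: \<eta> i x)
  case 0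
  from lcell_in_tile_bounds[OF 0(1,2)] show ?case by simp
next
  case (Suc j)
  obtain m i' where m: "x = lc m i'" "i' \<le> length lam" "1 \<le> m"
    using Suc.prems(1,3) by (rule tile_cell)
  then obtain j' where "m = Suc j'" by (metis Suc_le_D One_nat_def)
  with m have x: "x = lc (Suc j') i'" "i' \<le> length lam" by simp_all
  have down: "lc m p \<in> translate (1, -1) \<eta>" if "lc (Suc m) p \<in> \<eta>" for m p
  proof -
    have "lc m p \<in> translate (1, -1) (lc (Suc m) ` {p})" unfolding translate_lcell by simp
    also have "\<dots> \<subseteq> translate (1, -1) \<eta>" unfolding translate_def using that by (intro image_mono) simp
    finally show ?thesis .
  qed
  have i: "i \<le> length lam" using lcell_in_tile_bounds Suc.prems by blast
  consider "\<forall>y \<in> translate (1, -1) \<eta>. cell_below lam y"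
    | \<theta> where "\<theta> \<in> D" "translate (1, -1) \<eta> \<subseteq> \<theta>"
    using tiling Suc.prems(1) unfolding kdyck_tiling_def by blast
  then have "j' = j"
  proof cases
    case 1
    then have "cell_below lam (lc j i)" "cell_below lam (lc j' i')"
      using down Suc.prems x by auto
    then show ?thesis using cell_below_lcell_iff i x(2) by simp
  next
    case 2
    then have "lc j i \<in> \<theta>" "lc j' i' \<in> \<theta>" using down Suc.prems x by auto
    then obtain i'' where "lc j' i' = lc j i''" using Suc.IH[OF 2(1)] by blast
    then show ?thesis by simp
  qed
  then show ?case using x by blast
qed

lemma tile_shape:
  assumes "\<eta> \<in> D"
  obtains j a b where "1 \<le> j" "dyck_segment a b" "\<eta> = lc j ` {a..b}"
proof -
  have "\<eta> \<noteq> {}" using tiling assms by (auto simp: kdyck_tiling_def partition_on_def)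
  then obtain x where "x \<in> \<eta>" by blast
  then obtain j i where ji: "lc j i \<in> \<eta>" "1 \<le> j" using tile_cell[OF assms] by metis
  have "kdyck_tile k \<eta>" using tiling assms by (simp add: kdyck_tiling_def)
  then obtain a b where "dyck_segment a b" "\<eta> = lc j ` {a..b}"
    by (rule segment_of_kdyck_tile) (rule tile_constant_level[OF assms ji(1)])
  then show ?thesis using that ji(2) by blast
qed

lemma J_tile:
  assumes "p \<in> J j"
  obtains a b where "lc j ` {a..b} \<in> D" "dyck_segment a b" "a \<le> p" "p < b"
proof -
  obtain \<eta> where \<eta>: "\<eta> \<in> D" "lc j p \<in> \<eta>" "lc j (Suc p) \<in> \<eta>" using assms by (auto simp: J_def)
  obtain j' a b where s: "dyck_segment a b" "\<eta> = lc j' ` {a..b}" using tile_shape[OF \<eta>(1)] by metis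
  then show ?thesis using that[of a b] \<eta> by auto
qed

lemma in_J: "lc j ` {a..b} \<in> D \<Longrightarrow> a \<le> p \<Longrightarrow> p < b \<Longrightarrow> p \<in> J j"
  unfolding J_def mem_Collect_eq by (rule bexI[of _ "lc j ` {a..b}"]) simp_all

lemma J_bounds: "p \<in> J j \<Longrightarrow> p < length lam \<and> 1 \<le> j \<and> j \<le> h p \<and> j \<le> h (Suc p)"
proof -
  assume "p \<in> J j"
  then obtain \<eta> where "\<eta> \<in> D" "lc j p \<in> \<eta>" "lc j (Suc p) \<in> \<eta>" by (auto simp: J_def)
  then show ?thesis using lcell_in_tile_bounds[of \<eta> j p] lcell_in_tile_bounds[of \<eta> j "Suc p"] by simp
qed

text \<open>
  A tile containing an up step contains the whole arch, because it ends at its initial height.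
\<close>

lemma J_covers: "u \<in> J j \<Longrightarrow> covers u p \<Longrightarrow> p \<in> J j"
proof -
  assume u: "u \<in> J j" and cov: "covers u p"
  obtain a b where t: "lc j ` {a..b} \<in> D" "dyck_segment a b" "a \<le> u" "u < b"
    using u by (rule J_tile)
  then have "p < b" using dyck_segment_covers_inside cov by blast
  moreover have "a \<le> p" using t(3) cov by (simp add: covers_def)
  ultimately show ?thesis using t(1) by (intro in_J)
qed

text \<open>
  Inside a tile every down step has a matching up step.
\<close>

lemma J_covered: "p \<in> J j \<Longrightarrow> \<exists>u\<in>J j. covers u p"
proof -
  assume "p \<in> J j"
  then obtain a b where t: "lc j ` {a..b} \<in> D" "dyck_segment a b" "a \<le> p" "p < b" by (rule J_tile)
  obtain u where u: "a \<le> u" "u \<le> p" "covers u p" using t(2-) by (rule dyck_segment_covered)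
  have "u \<in> J j" using t u by (intro in_J[OF t(1)]) simp_all
  then show ?thesis using u(3) by (rule bexI[rotated])
qed

text \<open>
  Cover-inclusiveness: the translate of a tile of level \<open>Suc j\<close> is inside a tile of level \<open>j\<close>.
\<close>

lemma J_decreasing:
  assumes "1 \<le> j" "p \<in> J (Suc j)"
  shows "p \<in> J j"
proof -
  obtain a b where t: "lc (Suc j) ` {a..b} \<in> D" "dyck_segment a b" "a \<le> p" "p < b"
    using assms(2) by (rule J_tile)
  have "lc j a \<in> translate (1, -1) (lc (Suc j) ` {a..b})"
    using t by (simp add: translate_lcell)
  moreover have "\<not> cell_below lam (lc j a)"
    using assms(1) t by (simp add: cell_below_lcell_iff dyck_segment_def)
  ultimately obtain \<theta> where "\<theta> \<in> D" "translate (1, -1) (lc (Suc j) ` {a..b}) \<subseteq> \<theta>"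
    using tiling t(1) unfolding kdyck_tiling_def by blast
  then have "\<theta> \<in> D" "lc j ` {a..b} \<subseteq> \<theta>" by (simp_all add: translate_lcell)
  moreover have "lc j p \<in> lc j ` {a..b}" "lc j (Suc p) \<in> lc j ` {a..b}" using t by auto
  ultimately show ?thesis unfolding J_def by blast
qed

lemma in_J_iff:
  assumes "u < length lam" "lam ! u = Up" "1 \<le> j"
  shows "u \<in> J j \<longleftrightarrow> j \<le> c u"
proof -
  have "{j. u \<in> J j} = {1..card {j. u \<in> J j}}"
    by (rule down_closed_eq_atLeastAtMost_card[of _ "h u"]) (use J_decreasing J_bounds in auto)
  then have "u \<in> J j \<longleftrightarrow> j \<in> {1..card {j. u \<in> J j}}" by blast
  then show ?thesis using assms by (simp add: c_def)
qed

lemma joined_eq_J: "1 \<le> j \<Longrightarrow> joined c j = J j"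
proof -
  assume j: "1 \<le> j"
  have "u \<in> J j \<longleftrightarrow> j \<le> c u" if "covers u p" for u p
    using in_J_iff[of u j] that j by (auto simp: covers_def)
  then show ?thesis using J_covers J_covered unfolding joined_def by blast
qed

lemma h_outside: "length lam \<le> p \<Longrightarrow> h p = 0"
proof -
  assume "length lam \<le> p"
  then have "ups mu p = ups mu (length mu)" "ups lam p = ups lam (length lam)"
    by (simp_all add: ups_def length_mu)
  moreover have "ups mu (length mu) = N" "ups lam (length lam) = N"
    using mu kdyck unfolding kdyck_path_iff by blast+
  ultimately show ?thesis by (simp add: h_def)
qed

lemma is_profile_h_c: "is_profile h c"
  unfolding is_profile_def
proof (intro conjI allI impI)
  fix p assume p: "p < length lam"
  have "ups lam (Suc p) + h (Suc p) = ups lam p + h p + (if mu ! p = Up then 1 else 0)"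
    using ups_mu[of p] ups_mu[of "Suc p"] ups_Suc[of p mu] p length_mu by simp
  then show "if lam ! p = Up then h p = h (Suc p) \<or> h p = Suc (h (Suc p))
      else h (Suc p) = h p \<or> h (Suc p) = Suc (h p)"
    using ups_Suc[OF p] by (auto split: if_splits)
next
  fix u p assume cov: "covers u p"
  then have u: "u < length lam" "lam ! u = Up" by (auto simp: covers_def)
  have J: "p \<in> J (c u)" if "c u \<noteq> 0"
    using that in_J_iff[OF u, of "c u"] J_covers[OF _ cov] by simp
  then show "c u \<le> h p" "c u \<le> h (Suc p)" using J_bounds[of p "c u"] by (cases "c u"; simp)+
  assume "lam ! p = Up"
  then show "c u \<le> c p"
    using J J_bounds[of p "c u"] in_J_iff[of p "c u"] by (cases "c u = 0") auto
next
  show "h 0 = 0" by (simp add: h_def)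
qed (auto simp: h_outside c_def split: if_splits)

text \<open>
  Tiles of the same level are disjoint, so no link leads out of a tile.
\<close>

lemma component_of_tile:
  assumes t: "lc j ` {a..b} \<in> D" and p: "a \<le> p" "p \<le> b"
  shows "component (J j) p = {a..b}"
proof (intro equalityI subsetI)
  fix s assume s: "s \<in> component (J j) p"
  have neighbour: "i \<in> {a..b} \<longleftrightarrow> Suc i \<in> {a..b}" if "i \<in> J j" for i
  proof -
    obtain \<eta> where \<eta>: "\<eta> \<in> D" "lc j i \<in> \<eta>" "lc j (Suc i) \<in> \<eta>" using \<open>i \<in> J j\<close> by (auto simp: J_def)
    then have "\<eta> = lc j ` {a..b}" if "i \<in> {a..b} \<or> Suc i \<in> {a..b}"
      using that tiles_disjoint[OF \<eta>(1) t \<eta>(2)] tiles_disjoint[OF \<eta>(1) t \<eta>(3)] by auto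
    with \<eta>(2,3) show ?thesis by (cases "i \<in> {a..b} \<or> Suc i \<in> {a..b}") auto
  qed
  show "s \<in> {a..b}"
  proof (rule ccontr)
    assume "s \<notin> {a..b}"
    then consider "b < s" | "s < a" by fastforce
    then show False
    proof cases
      case 1
      then have "b \<in> J j" using s p by (auto simp: component_def)
      then show False using neighbour[of b] p by auto
    next
      case 2
      then have "s \<le> a - 1" "a - 1 < p" using p by auto
      then have "a - 1 \<in> J j" using s by (simp add: component_def)
      then show False using neighbour[of "a - 1"] 2 p by auto
    qed
  qed
next
  fix s assume "s \<in> {a..b}"
  then have "i \<in> J j" if "min s p \<le> i" "i < max s p" for i
    using that p by (intro in_J[OF t]) auto
  then show "s \<in> component (J j) p" by (simp add: component_def)
qed

lemma tiling_of_h_c: "tiling_of h c = D"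
proof (intro equalityI subsetI)
  fix \<eta> assume "\<eta> \<in> tiling_of h c"
  then obtain j p where \<eta>: "\<eta> = lc j ` component (joined c j) p" "p \<le> length lam" "1 \<le> j" "j \<le> h p"
    by (auto simp: tiling_of_def)
  then obtain \<theta> where \<theta>: "\<theta> \<in> D" "lc j p \<in> \<theta>" using union_tiles by blast
  obtain j' a b where "\<theta> = lc j' ` {a..b}" using tile_shape[OF \<theta>(1)] by metis
  then have "\<theta> = lc j ` {a..b}" "a \<le> p" "p \<le> b" using \<theta>(2) by auto
  then show "\<eta> \<in> D" using \<theta> component_of_tile \<eta> joined_eq_J by metis
next
  fix \<eta> assume \<eta>: "\<eta> \<in> D"
  then obtain j a b where s: "1 \<le> j" "dyck_segment a b" "\<eta> = lc j ` {a..b}" by (rule tile_shape)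
  then have "a \<le> b" by (simp add: dyck_segment_def)
  then have "\<eta> = lc j ` component (joined c j) a"
    using component_of_tile[of j a b a] \<eta> s joined_eq_J by simp
  moreover have "a \<le> length lam \<and> j \<le> h a"
    using lcell_in_tile_bounds[OF \<eta>, of j a] s \<open>a \<le> b\<close> by auto
  ultimately show "\<eta> \<in> tiling_of h c" using s(1) by (auto simp: tiling_of_def)
qed

text \<open>
  A tile with \<open>m\<close> up steps has \<open>(k+1)m+1\<close> cells.  Summing over all tiles, the area exceeds the number
  of tiles by \<open>(k+1) \<Sum>c\<close>, while the area itself is \<open>\<Sum>h\<close>.
\<close>

lemma art_eq: "art k D + (\<Sum>u<length lam. c u) = (\<Sum>i\<le>length lam. h i)"
proof -
  (* the up steps inside the tile, with its level *)
  define M where "M \<eta> = {(u, j). u < length lam \<and> lam ! u = Up \<and> lc j u \<in> \<eta> \<and> lc j (Suc u) \<in> \<eta>}" for \<eta>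
  have finD: "finite \<eta>" if "\<eta> \<in> D" for \<eta>
    using tile_shape[OF that] by (metis finite_atLeastAtMost finite_imageI)
  have fin: "finite D"
  proof (rule finite_UnionD)
    have "\<Union>D = region_between lam mu" using tiling by (simp add: kdyck_tiling_def partition_on_def)
    then show "finite (\<Union>D)" by (simp add: finite_region_between)
  qed
  have card_tile: "card \<eta> = (k + 1) * card (M \<eta>) + 1" "finite (M \<eta>)" if \<eta>: "\<eta> \<in> D" for \<eta>
  proof -
    obtain j a b where s: "1 \<le> j" "dyck_segment a b" "\<eta> = lc j ` {a..b}" using \<eta> by (rule tile_shape)
    have ab: "a \<le> b" "b \<le> length lam" "ht a = ht b" using s(2) by (auto simp: dyck_segment_def)
    have M: "M \<eta> = (\<lambda>u. (u, j)) ` {u\<in>{a..<b}. lam ! u = Up}"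
      using ab unfolding M_def s(3) by auto
    then show "finite (M \<eta>)" by simp
    have "card (M \<eta>) = card {u\<in>{a..<b}. lam ! u = Up}"
      unfolding M by (rule card_image) (simp add: inj_on_def)
    then have "ups lam b = ups lam a + card (M \<eta>)" using ups_eq_add_card[OF ab(1,2)] by simp
    then have "int b - int a = (int k + 1) * int (card (M \<eta>))"
      using ab(3) by (simp add: height_def algebra_simps)
    then have "int b = int (a + (k + 1) * card (M \<eta>))" by (simp add: algebra_simps)
    then have "b = a + (k + 1) * card (M \<eta>)" by (simp only: of_nat_eq_iff)
    moreover have "card \<eta> = b + 1 - a" unfolding s(3) by (subst card_image) (auto simp: inj_on_def)
    ultimately show "card \<eta> = (k + 1) * card (M \<eta>) + 1" by simp
  qed
  have area: "area D = (\<Sum>\<eta>\<in>D. card \<eta>)"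
    unfolding area_def using tiling finD
    by (intro card_Union_disjoint) (auto simp: kdyck_tiling_def partition_on_def disjoint_def pairwise_def disjnt_def)
  have "area D = card (SIGMA i:{..length lam}. {1..h i})"
    unfolding area_def union_tiles
    by (rule bij_betw_same_card[of "\<lambda>(i, j). lc j i", symmetric])
      (auto simp: bij_betw_def inj_on_def image_iff)
  then have area_h: "area D = (\<Sum>i\<le>length lam. h i)" by simp
  have "(\<Sum>\<eta>\<in>D. card (M \<eta>)) = card (\<Union>\<eta>\<in>D. M \<eta>)"
  proof (rule card_UN_disjoint[symmetric])
    show "\<forall>\<eta>\<in>D. \<forall>\<theta>\<in>D. \<eta> \<noteq> \<theta> \<longrightarrow> M \<eta> \<inter> M \<theta> = {}"
      using tiles_disjoint by (fastforce simp: M_def)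
  qed (use fin card_tile in auto)
  also have "(\<Union>\<eta>\<in>D. M \<eta>) = (SIGMA u:{..<length lam}. {1..c u})"
  proof -
    have "(u, j) \<in> (\<Union>\<eta>\<in>D. M \<eta>) \<longleftrightarrow> u < length lam \<and> lam ! u = Up \<and> u \<in> J j" for u j
      by (auto simp: M_def J_def)
    moreover have "lam ! u = Up \<and> u \<in> J j \<longleftrightarrow> 1 \<le> j \<and> j \<le> c u" if "u < length lam" for u j
      using in_J_iff[of u j] J_bounds[of u j] that by (cases "lam ! u = Up") (auto simp: c_def)
    ultimately show ?thesis by (intro set_eqI) (auto split: prod.splits; blast)
  qed
  also have "card \<dots> = (\<Sum>u<length lam. c u)" by simp
  finally have M: "(\<Sum>\<eta>\<in>D. card (M \<eta>)) = (\<Sum>u<length lam. c u)" .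
  have "area D = (k + 1) * (\<Sum>u<length lam. c u) + tiles D"
  proof -
    have "area D = (\<Sum>\<eta>\<in>D. (k + 1) * card (M \<eta>) + 1)"
      unfolding area using card_tile(1) by (rule sum.cong[OF refl])
    also have "\<dots> = (k + 1) * (\<Sum>\<eta>\<in>D. card (M \<eta>)) + card D"
      by (simp only: sum.distrib sum_distrib_left card_eq_sum)
    finally show ?thesis by (simp only: M tiles_def)
  qed
  moreover have "D \<in> kdyck_tilings k lam"
    using kdyck mu above tiling by (auto simp: kdyck_tilings_def)
  then have "(k + 1) * art k D = k * area D + tiles D" by (rule art_exact)
  ultimately have "(k + 1) * (art k D + (\<Sum>u<length lam. c u)) = (k + 1) * area D"
    by (simp add: algebra_simps)
  then have "art k D + (\<Sum>u<length lam. c u) = area D" by (simp only: mult_cancel1) simp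
  then show ?thesis using area_h by simp
qed

end

context lower_path
begin

lemma kdyck_tilings_obtain:
  assumes "D \<in> kdyck_tilings k lam"
  obtains mu where "tiled_path k lam N mu D"
proof -
  obtain n mu where m: "kdyck_path k n lam" "kdyck_path k n mu" "weakly_above mu lam" "kdyck_tiling k lam mu D"
    using assms by (auto simp: kdyck_tilings_def)
  have "n = N" using m(1) kdyck by (auto simp: kdyck_path_iff)
  then have "tiled_path k lam N mu D" using m by unfold_locales auto
  then show ?thesis by (rule that)
qed

context
  fixes h c
  assumes valid: "is_profile h c"
begin

text \<open>
  Monotonicity of \<open>c\<close> under arches is what makes the joined steps a union of arches.
\<close>

lemma joined_closed: "arch_closed (joined c j)"
  unfolding arch_closed_def
proof (intro conjI ballI allI impI)
  fix u p assume "u \<in> joined c j" "covers u p"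
  then obtain v where v: "covers v u" "j \<le> c v" by (auto simp: joined_def)
  have "c v \<le> c u" using valid v(1) \<open>covers u p\<close> unfolding is_profile_def by (metis covers_def)
  then show "p \<in> joined c j" using v \<open>covers u p\<close> by (auto simp: joined_def)
next
  fix p assume "p \<in> joined c j"
  then obtain u where u: "covers u p" "j \<le> c u" by (auto simp: joined_def)
  then have "covers u u" by (intro covers_refl) (auto simp: covers_def)
  then show "\<exists>u\<in>joined c j. covers u p" using u by (auto simp: joined_def)
qed

lemma joined_bounds: "p \<in> joined c j \<Longrightarrow> j \<le> h p \<and> j \<le> h (Suc p)"
proof -
  assume "p \<in> joined c j"
  then obtain u where "covers u p" "j \<le> c u" by (auto simp: joined_def)
  then show ?thesis using valid unfolding is_profile_def by (meson order_trans)
qed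

lemma joined_ascent_iff:
  assumes "u < length lam" "lam ! u = Up"
  shows "u \<in> joined c j \<longleftrightarrow> j \<le> c u"
proof
  assume "u \<in> joined c j"
  then obtain v where "covers v u" "j \<le> c v" by (auto simp: joined_def)
  then show "j \<le> c u" using valid assms(2) unfolding is_profile_def by (meson order_trans)
next
  assume "j \<le> c u"
  then show "u \<in> joined c j" using covers_refl[OF assms] by (auto simp: joined_def)
qed

lemma tile_interval:
  assumes "p \<le> length lam" "j \<le> h p"
  obtains a b where "dyck_segment a b" "component (joined c j) p = {a..b}" "a \<le> p" "p \<le> b"
    "\<And>s. s \<in> {a..b} \<Longrightarrow> s \<le> length lam \<and> j \<le> h s"
proof -
  obtain a b where ab: "a \<le> p" "p \<le> b" "b \<le> length lam" "component (joined c j) p = {a..b}"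
    "{a..<b} \<subseteq> joined c j" "a = 0 \<or> a - 1 \<notin> joined c j" "b \<notin> joined c j"
    using component_interval[OF assms(1)] arch_closed_less[OF joined_closed] by metis
  have "dyck_segment a b"
    using ab by (intro dyck_segment_of_run[OF joined_closed, of a b j]) auto
  moreover have "s \<le> length lam \<and> j \<le> h s" if s: "s \<in> {a..b}" for s
  proof (cases "s < b")
    case True
    then have "s \<in> joined c j" using s ab(5) by auto
    then show ?thesis using joined_bounds s ab(3) by auto
  next
    case False
    then have "s = b" using s by simp
    show ?thesis
    proof (cases "p = b")
      case False
      then have "b - 1 \<in> {a..<b}" "Suc (b - 1) = b" using ab(1,2) by auto
      then have "j \<le> h b" using ab(5) joined_bounds[of "b - 1" j] by (simp add: subset_iff)
      then show ?thesis using \<open>s = b\<close> ab(3) by simp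
    qed (use \<open>s = b\<close> assms in simp)
  qed
  ultimately show ?thesis using that ab by blast
qed

lemma union_tiling_of: "\<Union>(tiling_of h c) = {lc j i | j i. i \<le> length lam \<and> 1 \<le> j \<and> j \<le> h i}"
proof (intro equalityI subsetI)
  fix x assume "x \<in> \<Union>(tiling_of h c)"
  then obtain j p where jp: "x \<in> lc j ` component (joined c j) p" "p \<le> length lam" "1 \<le> j" "j \<le> h p"
    unfolding tiling_of_def by blast
  obtain a b where "dyck_segment a b" and ab: "component (joined c j) p = {a..b}"
    and "a \<le> p" "p \<le> b" and bounds: "\<And>s. s \<in> {a..b} \<Longrightarrow> s \<le> length lam \<and> j \<le> h s"
    using jp(2,4) by (rule tile_interval) (rule that)
  obtain s where "x = lc j s" "s \<in> {a..b}" using jp(1) unfolding ab by blast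
  then show "x \<in> {lc j i | j i. i \<le> length lam \<and> 1 \<le> j \<and> j \<le> h i}" using jp(3) bounds[of s] by blast
next
  fix x assume "x \<in> {lc j i | j i. i \<le> length lam \<and> 1 \<le> j \<and> j \<le> h i}"
  then obtain j i where x: "x = lc j i" "i \<le> length lam \<and> 1 \<le> j \<and> j \<le> h i" by blast
  then have "lc j ` component (joined c j) i \<in> tiling_of h c" unfolding tiling_of_def by blast
  moreover have "x \<in> lc j ` component (joined c j) i" using x(1) by simp
  ultimately show "x \<in> \<Union>(tiling_of h c)" by (rule UnionI)
qed

text \<open>
  The link function can be recovered from the tiling.
\<close>

lemma linked_iff:
  assumes "u < length lam" "lam ! u = Up"
  shows "(\<exists>\<eta>\<in>tiling_of h c. lc j u \<in> \<eta> \<and> lc j (Suc u) \<in> \<eta>) \<longleftrightarrow> 1 \<le> j \<and> j \<le> c u"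
proof
  assume "\<exists>\<eta>\<in>tiling_of h c. lc j u \<in> \<eta> \<and> lc j (Suc u) \<in> \<eta>"
  then obtain p where p: "u \<in> component (joined c j) p" "Suc u \<in> component (joined c j) p" "1 \<le> j"
    by (auto simp: tiling_of_def)
  then have "Suc u \<in> component (joined c j) u" using component_eq by blast
  then show "1 \<le> j \<and> j \<le> c u"
    using joined_ascent_iff[OF assms] p(3) by (simp add: Suc_in_component_iff)
next
  assume j: "1 \<le> j \<and> j \<le> c u"
  then have "u \<in> joined c j" using joined_ascent_iff[OF assms] by simp
  then have "Suc u \<in> component (joined c j) u" "j \<le> h u"
    using joined_bounds by (auto simp: Suc_in_component_iff)
  then show "\<exists>\<eta>\<in>tiling_of h c. lc j u \<in> \<eta> \<and> lc j (Suc u) \<in> \<eta>"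
    unfolding tiling_of_def using j assms(1) less_imp_le
    by (intro bexI[of _ "lc j ` component (joined c j) u"]) (simp, blast)
qed

text \<open>
  The upper path repeats the step of \<open>\<lambda>\<close> where \<open>h\<close> is constant and takes the other step where \<open>h\<close>
  changes.
\<close>

lemma ex_upper_path:
  obtains mu where "kdyck_path k N mu" "length mu = length lam"
    "\<And>i. i \<le> length lam \<Longrightarrow> ups mu i = ups lam i + h i"
proof -
  define mu where "mu = map (\<lambda>i. if h (Suc i) = h i then lam ! i
      else if lam ! i = Up then Down else Up) [0..<length lam]"
  have len: "length mu = length lam" by (simp add: mu_def)
  have ups_mu: "ups mu i = ups lam i + h i" if "i \<le> length lam" for i
    using that
  proof (induction i)
    case 0
    then show ?case using valid by (simp add: is_profile_def)
  next
    case (Suc i)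
    have "if lam ! i = Up then h i = h (Suc i) \<or> h i = Suc (h (Suc i))
        else h (Suc i) = h i \<or> h (Suc i) = Suc (h i)"
      using valid Suc.prems by (simp add: is_profile_def)
    then show ?case
      using Suc by (auto simp: ups_Suc len mu_def split: if_splits)
  qed
  have "kdyck_path k N mu"
    unfolding kdyck_path_iff
  proof (intro conjI allI impI)
    show "length mu = (k + 1) * N" using kdyck len by (simp add: kdyck_path_iff)
    show "ups mu (length mu) = N"
    proof -
      have "h (length lam) = 0" using valid by (simp add: is_profile_def)
      moreover have "ups lam (length lam) = N" using kdyck unfolding kdyck_path_iff by blast
      ultimately show ?thesis using ups_mu[of "length lam"] len by simp
    qed
    fix i assume "i \<le> length mu"
    then have "ht i \<le> height k mu i" using ups_mu[of i] len by (simp add: height_def algebra_simps)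
    then show "0 \<le> height k mu i" using ht_nonneg[of i] \<open>i \<le> length mu\<close> len by simp
  qed
  then show ?thesis using that len ups_mu by blast
qed

text \<open>
  A tile of level \<open>Suc j\<close> is a run of joined steps; as these are also joined at level \<open>j\<close>, its
  translate lies inside a tile of level \<open>j\<close>, which gives cover-inclusiveness.
\<close>

lemma tiling_of_in_kdyck_tilings: "tiling_of h c \<in> kdyck_tilings k lam"
proof -
  obtain mu where mu: "kdyck_path k N mu" "length mu = length lam"
    "\<And>i. i \<le> length lam \<Longrightarrow> ups mu i = ups lam i + h i"
    using ex_upper_path by blast
  have "\<Union>(tiling_of h c) = region_between lam mu"
    unfolding union_tiling_of region_between_eq[OF mu(1,2)]
    by (intro Collect_cong) (auto simp: mu(3))
  moreover have "disjoint (tiling_of h c)"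
  proof (rule disjointI)
    fix \<eta> \<theta> assume "\<eta> \<in> tiling_of h c" "\<theta> \<in> tiling_of h c" "\<eta> \<noteq> \<theta>"
    then obtain j p j' p' where e: "\<eta> = lc j ` component (joined c j) p"
      "\<theta> = lc j' ` component (joined c j') p'" unfolding tiling_of_def by blast
    show "\<eta> \<inter> \<theta> = {}"
    proof (rule ccontr)
      assume "\<eta> \<inter> \<theta> \<noteq> {}"
      then obtain s where "j = j'" "s \<in> component (joined c j) p" "s \<in> component (joined c j') p'"
        unfolding e by auto
      then show False using \<open>\<eta> \<noteq> \<theta>\<close> component_eq unfolding e by metis
    qed
  qed
  moreover have "{} \<notin> tiling_of h c"
  proof
    assume "{} \<in> tiling_of h c"
    then obtain j p where "lc j ` component (joined c j) p = {}" unfolding tiling_of_def by force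
    then show False using self_in_component[of p "joined c j"] by blast
  qed
  ultimately have "partition_on (region_between lam mu) (tiling_of h c)"
    by (simp add: partition_on_def)
  moreover have "kdyck_tile k \<eta> \<and> ((\<forall>x \<in> translate (1, -1) \<eta>. cell_below lam x) \<or>
      (\<exists>\<theta> \<in> tiling_of h c. \<theta> \<noteq> \<eta> \<and> translate (1, -1) \<eta> \<subseteq> \<theta>))" if \<eta>: "\<eta> \<in> tiling_of h c" for \<eta>
  proof -
    obtain j p where e: "\<eta> = lc (Suc j) ` component (joined c (Suc j)) p" "p \<le> length lam" "Suc j \<le> h p"
    proof -
      obtain m p where m: "\<eta> = lc m ` component (joined c m) p" "p \<le> length lam" "1 \<le> m" "m \<le> h p"
        using \<eta> unfolding tiling_of_def by blast
      moreover obtain j where "m = Suc j" using m(3) by (metis Suc_le_D One_nat_def)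
      ultimately show ?thesis using that by simp
    qed
    obtain a b where ab: "dyck_segment a b" "component (joined c (Suc j)) p = {a..b}"
      using e(2,3) by (rule tile_interval) (rule that)
    have "(\<forall>x \<in> translate (1, -1) \<eta>. cell_below lam x) \<or>
      (\<exists>\<theta> \<in> tiling_of h c. \<theta> \<noteq> \<eta> \<and> translate (1, -1) \<eta> \<subseteq> \<theta>)"
    proof (cases "j = 0")
      case True
      have "cell_below lam x" if "x \<in> translate (1, -1) \<eta>" for x
        using that ab True unfolding e(1) translate_lcell
        by (auto simp: cell_below_lcell_iff dyck_segment_def)
      then show ?thesis by blast
    next
      case False
      let ?\<theta> = "lc j ` component (joined c j) p"
      have "p \<le> length lam \<and> 1 \<le> j \<and> j \<le> h p" using False e by simp
      then have "?\<theta> \<in> tiling_of h c" unfolding tiling_of_def by blast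
      moreover have "?\<theta> \<noteq> \<eta>"
      proof
        assume "?\<theta> = \<eta>"
        moreover have "lc j p \<in> ?\<theta>" by simp
        ultimately show False unfolding e(1) by auto
      qed
      moreover have "joined c (Suc j) \<subseteq> joined c j" by (auto simp: joined_def)
      then have "translate (1, -1) \<eta> \<subseteq> ?\<theta>"
        unfolding e(1) translate_lcell by (intro image_mono component_mono)
      ultimately show ?thesis by blast
    qed
    then show ?thesis using kdyck_tile_segment[OF ab(1), of "Suc j"] ab(2) e(1) by simp
  qed
  ultimately have "kdyck_tiling k lam mu (tiling_of h c)"
    unfolding kdyck_tiling_def by blast
  moreover have "weakly_above mu lam"
    using mu by (auto simp: weakly_above_def path_point_eq)
  ultimately show ?thesis using kdyck mu(1) unfolding kdyck_tilings_def by blast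
qed

end

lemma tiling_of_inj:
  assumes v: "is_profile h c" "is_profile h' c'" and eq: "tiling_of h c = tiling_of h' c'"
  shows "h = h' \<and> c = c'"
proof
  show "h = h'"
  proof
    fix i
    show "h i = h' i"
    proof (cases "i \<le> length lam")
      case True
      have "1 \<le> j \<and> j \<le> h i \<longleftrightarrow> lc j i \<in> \<Union>(tiling_of h c)" for j
        unfolding union_tiling_of[OF v(1)] using True by auto
      moreover have "1 \<le> j \<and> j \<le> h' i \<longleftrightarrow> lc j i \<in> \<Union>(tiling_of h c)" for j
        unfolding eq union_tiling_of[OF v(2)] using True by auto
      ultimately have "{1..h i} = {1..h' i}" by (simp add: set_eq_iff)
      then show ?thesis by (metis card_atLeastAtMost diff_Suc_1)
    qed (use v in \<open>auto simp: is_profile_def\<close>)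
  qed
  show "c = c'"
  proof
    fix u
    show "c u = c' u"
    proof (cases "u < length lam \<and> lam ! u = Up")
      case True
      then have "{1..c u} = {1..c' u}"
        using linked_iff[OF v(1), of u] linked_iff[OF v(2), of u] eq by (auto simp: set_eq_iff)
      then show ?thesis by (metis card_atLeastAtMost diff_Suc_1)
    next
      case False
      then have "c u = 0" "c' u = 0" using v unfolding is_profile_def by blast+
      then show ?thesis by simp
    qed
  qed
qed

lemma kdyck_tilings_decompose:
  assumes "D \<in> kdyck_tilings k lam"
  obtains h c where "is_profile h c" "tiling_of h c = D"
    "art k D + (\<Sum>u<length lam. c u) = (\<Sum>i\<le>length lam. h i)"
proof -
  obtain mu where t: "tiled_path k lam N mu D" using assms by (rule kdyck_tilings_obtain)
  show ?thesis
    by (rule that[OF tiled_path.is_profile_h_c[OF t] tiled_path.tiling_of_h_c[OF t] tiled_path.art_eq[OF t]])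
qed

lemma art_tiling_of:
  assumes "is_profile h c"
  shows "art k (tiling_of h c) + (\<Sum>u<length lam. c u) = (\<Sum>i\<le>length lam. h i)"
proof -
  obtain h' c' where v: "is_profile h' c'" "tiling_of h' c' = tiling_of h c"
    and art: "art k (tiling_of h c) + (\<Sum>u<length lam. c' u) = (\<Sum>i\<le>length lam. h' i)"
    using tiling_of_in_kdyck_tilings[OF assms] by (rule kdyck_tilings_decompose)
  have "h' = h \<and> c' = c" using tiling_of_inj[OF v(1) assms v(2)] .
  then show ?thesis using art by simp
qed

end

section \<open>Tilings as weighted walks\<close>

fun walks :: "step list \<Rightarrow> nat \<times> nat \<Rightarrow> (nat \<times> nat) list set" where
  "walks [] x = (if fst x = 0 then {[]} else {})"
| "walks (s # p) x = (\<Union>y\<in>moves s x. (#) y ` walks p y)"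

definition weight :: "(nat \<times> nat) list \<Rightarrow> nat" where
  "weight w = (\<Sum>y\<leftarrow>w. fst y - snd y)"

lemma finite_walks: "finite (walks p x)"
  by (induction p arbitrary: x) (auto simp: finite_moves)

text \<open>
  Splitting off the first step of a walk turns the sum over walks into a product of transfer
  operators.
\<close>

lemma sum_walks:
  "(\<Sum>w\<in>walks p x. q ^ weight w) = foldr transfer p (\<lambda>x. if fst x = 0 then 1 else 0) x"
proof (induction p arbitrary: x)
  case Nil
  then show ?case by (simp add: weight_def)
next
  case (Cons s p)
  have "(\<Sum>w\<in>walks (s # p) x. q ^ weight w) = (\<Sum>y\<in>moves s x. \<Sum>w\<in>(#) y ` walks p y. q ^ weight w)"
    unfolding walks.simps by (rule sum.UNION_disjoint) (auto simp: finite_moves finite_walks)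
  also have "\<dots> = (\<Sum>y\<in>moves s x. q ^ (fst y - snd y) * (\<Sum>w\<in>walks p y. q ^ weight w))"
    by (intro sum.cong refl) (simp add: sum.reindex weight_def power_add sum_distrib_left)
  finally show ?case by (simp only: Cons.IH foldr.simps(2) o_apply transfer_def[of s])
qed

lemma walks_iff:
  "w \<in> walks p x \<longleftrightarrow> length w = length p
     \<and> (\<forall>i<length p. (x # w) ! Suc i \<in> moves (p ! i) ((x # w) ! i)) \<and> fst ((x # w) ! length p) = 0"
proof (induction p arbitrary: x w)
  case (Cons s p)
  show ?case
  proof (cases w)
    case (Cons y v)
    have "y # v \<in> walks (s # p) x \<longleftrightarrow> y \<in> moves s x \<and> v \<in> walks p y"
      unfolding walks.simps by blast
    then show ?thesis unfolding Cons by (auto simp: Cons.IH All_less_Suc2)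
  qed auto
qed auto

context lower_path
begin

definition walk_of :: "(nat \<Rightarrow> nat) \<Rightarrow> (nat \<Rightarrow> nat) \<Rightarrow> (nat \<times> nat) list" where
  "walk_of h c = map (\<lambda>i. (h (Suc i), c i)) [0..<length lam]"

definition heights_of :: "(nat \<times> nat) list \<Rightarrow> nat \<Rightarrow> nat" where
  "heights_of w i = (if i \<le> length lam then fst (((0, 0) # w) ! i) else 0)"

definition links_of :: "(nat \<times> nat) list \<Rightarrow> nat \<Rightarrow> nat" where
  "links_of w i = (if i < length lam then snd (w ! i) else 0)"

lemma links_le_height: "is_profile h c \<Longrightarrow> c i \<le> h (Suc i)"
proof -
  assume v: "is_profile h c"
  show ?thesis
  proof (cases "c i = 0")
    case False
    then have "covers i i" using v by (intro covers_refl) (auto simp: is_profile_def)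
    then show ?thesis using v unfolding is_profile_def by blast
  qed simp
qed

text \<open>
  Consecutive up steps lie under each other's arches, which gives the monotonicity demanded by
  \<open>moves\<close>.  Here \<open>k \<ge> 1\<close> ensures that an up step increases \<open>ky - x\<close>.
\<close>

lemma walk_of_in_walks:
  assumes v: "is_profile h c" and "k \<ge> 1"
  shows "walk_of h c \<in> walks lam (0, 0)"
  unfolding walks_iff
proof (intro conjI allI impI)
  have state: "((0, 0) # walk_of h c) ! i = (h i, if i = 0 then 0 else c (i - 1))" if "i \<le> length lam" for i
    using that v by (cases i) (auto simp: walk_of_def is_profile_def)
  show "fst (((0, 0) # walk_of h c) ! length lam) = 0"
    using v by (simp add: state is_profile_def)
  fix i assume i: "i < length lam"
  have states: "((0, 0) # walk_of h c) ! Suc i = (h (Suc i), c i)"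
    "((0, 0) # walk_of h c) ! i = (h i, if i = 0 then 0 else c (i - 1))"
    using state[of "Suc i"] state[of i] i by (simp_all del: nth_Cons_Suc)
  have step: "if lam ! i = Up then h i = h (Suc i) \<or> h i = Suc (h (Suc i))
      else h (Suc i) = h i \<or> h (Suc i) = Suc (h i)"
    using v i by (simp add: is_profile_def)
  show "((0, 0) # walk_of h c) ! Suc i \<in> moves (lam ! i) (((0, 0) # walk_of h c) ! i)"
  proof (cases "lam ! i")
    case Up
    have "(if i = 0 then 0 else c (i - 1)) \<le> c i"
    proof (cases "i = 0 \<or> c (i - 1) = 0")
      case False
      then have prev: "lam ! (i - 1) = Up" "Suc (i - 1) = i" using v by (auto simp: is_profile_def)
      then have "ht (i - 1) < ht i" using height_Suc[of "i - 1" lam k] i \<open>k \<ge> 1\<close> by simp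
      moreover have "s = i" if "i - 1 < s" "s \<le> i" for s using that by simp
      ultimately have "covers (i - 1) i" using prev(1) i unfolding covers_def by auto
      then show ?thesis using v Up unfolding is_profile_def by auto
    qed auto
    then show ?thesis using step links_le_height[OF v, of i] Up unfolding states by auto
  next
    case Down
    then have "c i = 0" using v by (auto simp: is_profile_def)
    then show ?thesis using step Down unfolding states by auto
  qed
qed (simp add: walk_of_def)

lemma heights_of_walk_of: "is_profile h c \<Longrightarrow> heights_of (walk_of h c) = h"
proof
  fix i assume v: "is_profile h c"
  show "heights_of (walk_of h c) i = h i"
    using v by (cases i) (auto simp: heights_of_def walk_of_def is_profile_def)
qed

lemma links_of_walk_of: "is_profile h c \<Longrightarrow> links_of (walk_of h c) = c"
proof
  fix i assume v: "is_profile h c"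
  show "links_of (walk_of h c) i = c i"
  proof (cases "i < length lam")
    case False
    then have "c i = 0" using v unfolding is_profile_def by blast
    then show ?thesis using False by (simp add: links_of_def)
  qed (simp add: links_of_def walk_of_def)
qed

lemma walk_of_heights_links: "length w = length lam \<Longrightarrow> walk_of (heights_of w) (links_of w) = w"
  by (rule nth_equalityI) (auto simp: walk_of_def heights_of_def links_of_def)

lemma art_eq_weight:
  assumes v: "is_profile h c"
  shows "art k (tiling_of h c) = weight (walk_of h c)"
proof -
  have "weight (walk_of h c) = (\<Sum>i<length lam. h (Suc i) - c i)"
    by (simp add: weight_def walk_of_def o_def sum_list_distinct_conv_sum_set lessThan_atLeast0)
  then have "weight (walk_of h c) + (\<Sum>i<length lam. c i) = (\<Sum>i<length lam. h (Suc i))"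
    using links_le_height[OF v] by (simp flip: sum.distrib)
  also have "\<dots> = (\<Sum>i\<le>length lam. h i)"
    using v by (simp add: is_profile_def sum.lessThan_Suc_shift flip: lessThan_Suc_atMost del: sum.lessThan_Suc)
  also have "\<dots> = art k (tiling_of h c) + (\<Sum>i<length lam. c i)"
    by (rule art_tiling_of[OF v, symmetric])
  finally show ?thesis by simp
qed

text \<open>
  When all valleys are at height \<open>0\<close>, no arch contains a valley in its interior.  Under an arch the
  path therefore goes first up and then down, and the local inequalities propagate step by step along
  the arch.
\<close>

lemma covers_bounds:
  fixes c h :: "nat \<Rightarrow> nat"
  assumes valleys: "\<And>i. Suc i < length lam \<Longrightarrow> lam ! i = Down \<Longrightarrow> lam ! Suc i = Up \<Longrightarrow> ht (Suc i) = 0"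
    and up: "\<And>i. i < length lam \<Longrightarrow> lam ! i = Up \<Longrightarrow> c i \<le> h (Suc i) \<and> h (Suc i) \<le> h i"
    and down: "\<And>i. i < length lam \<Longrightarrow> lam ! i = Down \<Longrightarrow> h i \<le> h (Suc i)"
    and up_up: "\<And>i. Suc i < length lam \<Longrightarrow> lam ! i = Up \<Longrightarrow> lam ! Suc i = Up \<Longrightarrow> c i \<le> c (Suc i)"
    and cov: "covers u p"
  shows "c u \<le> h p \<and> c u \<le> h (Suc p) \<and> (lam ! p = Up \<longrightarrow> c u \<le> c p)"
proof -
  have "u \<le> p" using cov by (simp add: covers_def)
  then show ?thesis using cov
  proof (induction p rule: dec_induct)
    case base
    then have "u < length lam" "lam ! u = Up" by (auto simp: covers_def)
    then have "c u \<le> h (Suc u)" "h (Suc u) \<le> h u" using up[of u] by blast+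
    then have "c u \<le> h u" by (rule order_trans)
    then show ?case using \<open>c u \<le> h (Suc u)\<close> by simp
  next
    case (step p)
    have cov_p: "covers u p" and p: "Suc p < length lam" "ht u < ht (Suc p)"
      using step.prems step.hyps by (auto simp: covers_def)
    note IH = step.IH[OF cov_p]
    show ?case
    proof (cases "lam ! Suc p")
      case Up
      have "lam ! p = Up"
      proof (rule ccontr)
        assume "lam ! p \<noteq> Up"
        then have "ht (Suc p) = 0" using valleys[OF p(1)] Up by (cases "lam ! p") auto
        moreover have "0 \<le> ht u" using ht_nonneg[of u] p step.hyps by simp
        ultimately show False using p(2) by simp
      qed
      then have "c u \<le> c (Suc p)" using IH up_up[OF p(1)] Up by auto
      then show ?thesis using IH up[OF p(1) Up] by auto
    next
      case Down
      then show ?thesis using IH down[OF p(1)] by auto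
    qed
  qed
qed

lemma is_profile_of_walk:
  assumes valleys: "\<And>i. Suc i < length lam \<Longrightarrow> lam ! i = Down \<Longrightarrow> lam ! Suc i = Up \<Longrightarrow> ht (Suc i) = 0"
    and w: "w \<in> walks lam (0, 0)"
  shows "is_profile (heights_of w) (links_of w)"
proof -
  let ?h = "heights_of w" and ?c = "links_of w"
  have len: "length w = length lam" using w by (simp add: walks_iff)
  have state: "((0, 0) # w) ! Suc i = (?h (Suc i), ?c i)" if "i < length lam" for i
    using that by (simp add: heights_of_def links_of_def)
  have move: "(?h (Suc i), ?c i) \<in> moves (lam ! i) (((0, 0) # w) ! i)" if "i < length lam" for i
    using w that by (simp add: walks_iff flip: state)
  have fst_state: "((0, 0) # w) ! i = (?h i, snd (((0, 0) # w) ! i))" if "i \<le> length lam" for i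
    using that by (simp add: heights_of_def)
  have up: "(?h i = ?h (Suc i) \<or> ?h i = Suc (?h (Suc i))) \<and> snd (((0, 0) # w) ! i) \<le> ?c i \<and> ?c i \<le> ?h (Suc i)"
    if "i < length lam" "lam ! i = Up" for i
  proof -
    have "(?h (Suc i), ?c i) \<in> moves Up (?h i, snd (((0, 0) # w) ! i))"
      using move[of i] fst_state[of i] that by simp
    then show ?thesis by auto
  qed
  have down: "(?h (Suc i) = ?h i \<or> ?h (Suc i) = Suc (?h i)) \<and> ?c i = 0"
    if "i < length lam" "lam ! i = Down" for i
  proof -
    have "(?h (Suc i), ?c i) \<in> moves Down (?h i, snd (((0, 0) # w) ! i))"
      using move[of i] fst_state[of i] that by simp
    then show ?thesis by auto
  qed
  have final: "?h (length lam) = 0" using w by (simp add: walks_iff heights_of_def)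
  show ?thesis
    unfolding is_profile_def
  proof (intro conjI allI impI)
    show "?h 0 = 0" by (simp add: heights_of_def)
    fix p assume "length lam \<le> p"
    then show "?h p = 0" using final by (cases "p = length lam") (auto simp: heights_of_def)
  next
    fix p assume "p < length lam"
    then show "if lam ! p = Up then ?h p = ?h (Suc p) \<or> ?h p = Suc (?h (Suc p))
        else ?h (Suc p) = ?h p \<or> ?h (Suc p) = Suc (?h p)"
      using up[of p] down[of p] by (cases "lam ! p") simp_all
  next
    fix u assume u: "?c u \<noteq> 0"
    then show "u < length lam" by (simp add: links_of_def split: if_splits)
    then show "lam ! u = Up" using u down[of u] by (cases "lam ! u") auto
  next
    fix u p assume cov: "covers u p"
    have "?c u \<le> ?h p \<and> ?c u \<le> ?h (Suc p) \<and> (lam ! p = Up \<longrightarrow> ?c u \<le> ?c p)"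
    proof (rule covers_bounds)
      fix i assume "Suc i < length lam" "lam ! i = Down" "lam ! Suc i = Up"
      then show "ht (Suc i) = 0" by (rule valleys)
    next
      fix i assume "i < length lam" "lam ! i = Up"
      then show "?c i \<le> ?h (Suc i) \<and> ?h (Suc i) \<le> ?h i" using up[of i] by auto
    next
      fix i assume "i < length lam" "lam ! i = Down"
      then show "?h i \<le> ?h (Suc i)" using down[of i] by auto
    next
      fix i assume i: "Suc i < length lam" "lam ! Suc i = Up"
      have "snd (((0, 0) # w) ! Suc i) = ?c i" using state[of i] i by simp
      then show "?c i \<le> ?c (Suc i)" using up[of "Suc i"] i by simp
    qed (use cov in simp_all)
    then show "?c u \<le> ?h p" "?c u \<le> ?h (Suc p)" "lam ! p = Up \<Longrightarrow> ?c u \<le> ?c p" by simp_all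
  qed
qed

lemma sum_kdyck_tilings_eq_sum_walks:
  assumes "k \<ge> 1"
    and valleys: "\<And>i. Suc i < length lam \<Longrightarrow> lam ! i = Down \<Longrightarrow> lam ! Suc i = Up \<Longrightarrow> ht (Suc i) = 0"
  shows "(\<Sum>D\<in>kdyck_tilings k lam. q ^ art k D) = (\<Sum>w\<in>walks lam (0, 0). q ^ weight w)"
proof -
  let ?f = "\<lambda>w. tiling_of (heights_of w) (links_of w)"
  have w: "is_profile (heights_of w) (links_of w)" "walk_of (heights_of w) (links_of w) = w"
    if "w \<in> walks lam (0, 0)" for w
  proof -
    show "is_profile (heights_of w) (links_of w)"
      using valleys that by (rule is_profile_of_walk)
    show "walk_of (heights_of w) (links_of w) = w"
      using that by (intro walk_of_heights_links) (simp add: walks_iff)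
  qed
  have inj: "inj_on ?f (walks lam (0, 0))"
  proof (rule inj_onI)
    fix v w assume v': "v \<in> walks lam (0, 0)" and w': "w \<in> walks lam (0, 0)" and eq: "?f v = ?f w"
    have same: "heights_of v = heights_of w \<and> links_of v = links_of w"
      by (rule tiling_of_inj[OF w(1)[OF v'] w(1)[OF w'] eq])
    have "v = walk_of (heights_of v) (links_of v)" by (rule w(2)[OF v', symmetric])
    also have "\<dots> = walk_of (heights_of w) (links_of w)" by (simp only: same)
    also have "\<dots> = w" by (rule w(2)[OF w'])
    finally show "v = w" .
  qed
  have image: "?f ` walks lam (0, 0) = kdyck_tilings k lam"
  proof (intro equalityI subsetI)
    fix D assume "D \<in> ?f ` walks lam (0, 0)"
    then obtain v where v: "v \<in> walks lam (0, 0)" "D = ?f v" by (rule imageE)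
    show "D \<in> kdyck_tilings k lam" unfolding v(2) by (rule tiling_of_in_kdyck_tilings[OF w(1)[OF v(1)]])
  next
    fix D assume "D \<in> kdyck_tilings k lam"
    then obtain h c where v: "is_profile h c" "tiling_of h c = D" by (rule kdyck_tilings_decompose)
    have "?f (walk_of h c) = D"
      using v by (simp add: heights_of_walk_of links_of_walk_of)
    then show "D \<in> ?f ` walks lam (0, 0)"
      using walk_of_in_walks[OF v(1) assms(1)] by (intro image_eqI[of _ _ "walk_of h c"]) simp_all
  qed
  have "(\<Sum>D\<in>kdyck_tilings k lam. q ^ art k D) = (\<Sum>w\<in>walks lam (0, 0). q ^ art k (?f w))"
    unfolding image[symmetric] by (simp add: sum.reindex[OF inj])
  also have "\<dots> = (\<Sum>w\<in>walks lam (0, 0). q ^ weight w)"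
    by (intro sum.cong refl) (simp add: art_eq_weight w)
  finally show ?thesis .
qed

end

section \<open>The product formula\<close>

text \<open>
  A valley separates two hills, and every hill returns to height \<open>0\<close>.
\<close>

lemma zigzag_valleys:
  assumes "Suc i < length (zigzag_path k n l)"
    and "zigzag_path k n l ! i = Down" "zigzag_path k n l ! Suc i = Up"
  shows "height k (zigzag_path k n l) (Suc i) = 0"
  using assms
proof (induction l)
  case 0
  then show ?case by (simp add: zigzag_path_def)
next
  case (Suc l)
  let ?p = "zigzag_path k n l" and ?u = "replicate (n (Suc l)) Up" and ?d = "replicate (k * n (Suc l)) Down"
  have height_append: "height k (?p @ ?u @ ?d) j = height k ?p j" if "j \<le> length ?p" for j
    using that by (simp add: height_def ups_def)
  consider "Suc i < length ?p" | "Suc i = length ?p" | "length ?p \<le> i" by linarith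
  then show ?case
  proof cases
    case 1
    then show ?thesis
      using Suc height_append[of "Suc i"] unfolding zigzag_path_Suc by (simp add: nth_append)
  next
    case 2
    then show ?thesis
      using height_append[of "Suc i"] height_end[OF kdyck_path_zigzag[of k n l]]
      unfolding zigzag_path_Suc by simp
  next
    case 3
    then obtain t where i: "i = length ?p + t" by (metis le_Suc_ex)
    have "(?u @ ?d) ! t = Down" "(?u @ ?d) ! Suc t = Up" "Suc t < length (?u @ ?d)"
      using Suc.prems unfolding zigzag_path_Suc i by (simp_all add: nth_append)
    then show ?thesis by (auto simp: nth_append split: if_splits)
  qed
qed

theorem theorem3p3:
  fixes k l :: nat and n :: "nat \<Rightarrow> nat"
  assumes "k \<ge> 1" and "l \<ge> 1"
    and "\<And>i. i \<in> {1..l} \<Longrightarrow> n i > 0"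
  shows "(\<Sum>D \<in> kdyck_tilings k (zigzag_path k n l). q ^ art k D) =
         (\<Prod>j = 2..l. q_binom (k * (\<Sum>i = 1..<j. n i) + n j) (n j))"
proof -
  let ?e = "\<lambda>x :: nat \<times> nat. if fst x = 0 then 1 else 0 :: int poly"
  interpret lower_path k "zigzag_path k n l" "\<Sum>i = 1..l. n i"
    by unfold_locales (rule kdyck_path_zigzag)
  have "(\<Sum>D \<in> kdyck_tilings k (zigzag_path k n l). q ^ art k D)
      = foldr transfer (zigzag_path k n l) ?e (0, 0)"
  proof (rule trans)
    show "(\<Sum>D \<in> kdyck_tilings k (zigzag_path k n l). q ^ art k D)
        = (\<Sum>w\<in>walks (zigzag_path k n l) (0, 0). q ^ weight w)"
      by (rule sum_kdyck_tilings_eq_sum_walks[OF assms(1)]) (rule zigzag_valleys)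
  qed (rule sum_walks)
  also have "\<dots> = (\<Prod>j = 1..l. gauss (k * (\<Sum>i = 1..<j. n i) + n j) (n j))
      * binomial_functional (k * (\<Sum>i = 1..l. n i)) (\<lambda>a. ?e (a, 0))"
    using assms(1,3) by (rule transfer_zigzag)
  also have "binomial_functional m (\<lambda>a. ?e (a, 0)) = 1" for m
  proof -
    have "binomial_functional m (\<lambda>a. ?e (a, 0))
        = (\<Sum>a\<in>{0}. q ^ (Suc a choose 2) * gauss m a * ?e (a, 0))"
      unfolding binomial_functional_def by (intro sum.mono_neutral_right) auto
    then show ?thesis by (simp add: numeral_2_eq_2)
  qed
  also have "(\<Prod>j = 1..l. gauss (k * (\<Sum>i = 1..<j. n i) + n j) (n j)) * 1
      = (\<Prod>j = 2..l. q_binom (k * (\<Sum>i = 1..<j. n i) + n j) (n j))"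
  proof -
    (* the first hill contributes [n 1 choose n 1] = 1 *)
    have "{1..l} = insert 1 {2..l}" using assms(2) by auto
    then show ?thesis by (simp add: gauss_eq_q_binom[symmetric])
  qed
  finally show ?thesis .
qed

end
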